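(* Let $\alpha\in(0,2)$, let $Z$ be the standard isotropic stable process of index $\alpha$ in $\mathbb{C}$ with $Z_0=1$, and let $\theta$ be the process of its winding number around $0$. Let $(\zeta_t,t\ge0)$ be the symmetric one-dimensional $\alpha$-stable process which is the limit in distribution of $(c^{-1/\alpha}\theta_{ct},t\ge0)$ as $c\to0$. Let $0<a,b\le\infty$ be fixed. Then, as $c\to0$, the following convergences in law hold: $$\frac1c\,T^{\theta}_{ac^{1/\alpha}}\longrightarrow T^{\zeta}_a,\qquad \frac1c\,T^{|\theta|}_{ac^{1/\alpha}}\longrightarrow T^{|\zeta|}_a,\qquad \frac1c\,T^{\theta}_{-bc^{1/\alpha},\,ac^{1/\alpha}}\longrightarrow T^{\zeta}_{-b,a}.$$ Here, for $x,y>0$: $T^{\theta}_x=\inf\{t:\theta_t\ge x\}$, $T^{|\theta|}_x=\inf\{t:|\theta_t|\ge x\}$, $T^{\theta}_{-y,x}=\inf\{t:\theta_t\notin(-y,x)\}$, while $T^{\zeta}_x=\inf\{t:\zeta_t=x\}$, $T^{|\zeta|}_x=\inf\{t:|\zeta_t|=x\}$ and $T^{\zeta}_{-y,x}=\inf\{t:\zeta_t\notin(-y,x)\}$.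
   Context: $Z=(Z_t,t\ge0)$ is the standard isotropic stable process of index $\alpha\in(0,2)$ taking values in $\mathbb{C}$ and starting from $1$: it has stationary independent increments, cadlag paths, and $E[\exp(i\langle\lambda,Z_t-Z_0\rangle)]=\exp(-t|\lambda|^{\alpha})$ for all $t\ge0$, $\lambda\in\mathbb{C}$, where $\langle\cdot,\cdot\rangle$ is the Euclidean inner product. Almost surely, $Z$ never visits $0$ and has no jumps across $0$. Winding process $\theta=(\theta_t,t\ge0)$: the path of $Z$ on $[0,t]$ is completed into a continuous curve starting at $1$ by filling in the gaps (jumps) with line segments; a.s. this curve avoids $0$, and $\theta_t$ is the signed total angle it winds around $0$. The process $\theta$ has cadlag paths with jumps of absolute size less than $\pi$, and $\exp(i\theta_t)=Z_t/|Z_t|$ for all $t\ge0$. The family $(c^{-1/\alpha}\theta_{ct},t\ge0)$ converges in distribution on $D([0,\infty),\mathbb{R})$ endowed with the Skorohod topology, as $c\to0$, to a symmetric one-dimensional $\alpha$-stable process $\zeta$.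
   Formalization: The limits T^ζ_a and T^{|ζ|}_a are taken as first passage times inf{t: ζ_t ≥ a} and inf{t: |ζ_t| ≥ a}, not inf{t: ζ_t = a} and inf{t: |ζ_t| = a}: the stable process jumps over a finite level, so the printed claim fails (for α ≤ 1 the hitting times of points are infinite a.s.). *)

theory Defs
  imports "HOL-Probability.Probability" "HOL-Complex_Analysis.Complex_Analysis"
begin

section \<open>Path space\<close>

text \<open>Paths indexed by $[0,\infty)$ are functions on all of \<^typ>\<open>real\<close>; no notion below depends on
  their values at negative times.\<close>

definition cadlag :: "(real \<Rightarrow> 'a::topological_space) \<Rightarrow> bool" where
  "cadlag f \<longleftrightarrow>
     (\<forall>t\<ge>0. (f \<longlongrightarrow> f t) (at_right t)) \<and> (\<forall>t>0. \<exists>l. (f \<longlongrightarrow> l) (at_left t))"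

definition time_change :: "(real \<Rightarrow> real) \<Rightarrow> bool" where
  "time_change l \<longleftrightarrow> strict_mono_on {0..} l \<and> bij_betw l {0..} {0..}"

text \<open>The Skorohod (J1) topology on $D([0,\infty),R)$, given by its basic neighbourhoods. A sequence
  $y_n$ is eventually in every \<open>skorohod_nbhd x T e\<close> iff there are time changes $l_n$ such that
  $\sup_{s} |l_n(s) - s| \to 0$ and $\sup_{s \le T} |y_n(l_n(s)) - x(s)| \to 0$ for every $T$,
  which is the usual description of convergence in this metrizable topology.\<close>

definition skorohod_nbhd :: "(real \<Rightarrow> real) \<Rightarrow> real \<Rightarrow> real \<Rightarrow> (real \<Rightarrow> real) set" where
  "skorohod_nbhd x T e =
     {y. cadlag y \<and> (\<exists>l. time_change l \<and> (\<forall>s\<ge>0. \<bar>l s - s\<bar> < e) \<and> (\<forall>s\<in>{0..T}. \<bar>y (l s) - x s\<bar> < e))}"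

definition skorohod_open :: "(real \<Rightarrow> real) set \<Rightarrow> bool" where
  "skorohod_open U \<longleftrightarrow>
     U \<subseteq> Collect cadlag \<and> (\<forall>x\<in>U. \<exists>T. \<exists>e>0. skorohod_nbhd x T e \<subseteq> U)"

definition skorohod_topology :: "(real \<Rightarrow> real) topology" where
  "skorohod_topology = topology skorohod_open"

lemma skorohod_nbhd_mono:
  assumes "T \<le> T'" "e' \<le> e"
  shows "skorohod_nbhd x T' e' \<subseteq> skorohod_nbhd x T e"
proof
  fix y assume "y \<in> skorohod_nbhd x T' e'"
  then obtain l where y: "cadlag y" and l: "time_change l" "\<forall>s\<ge>0. \<bar>l s - s\<bar> < e'"
    "\<forall>s\<in>{0..T'}. \<bar>y (l s) - x s\<bar> < e'"
    unfolding skorohod_nbhd_def by blast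
  have "\<bar>l s - s\<bar> < e" if "s \<ge> 0" for s
    using l(2) that assms(2) less_le_trans by blast
  moreover have "\<bar>y (l s) - x s\<bar> < e" if "s \<in> {0..T}" for s
  proof -
    have "s \<in> {0..T'}" using that assms(1) by simp
    then show ?thesis using l(3) assms(2) less_le_trans by blast
  qed
  ultimately show "y \<in> skorohod_nbhd x T e"
    using y l(1) unfolding skorohod_nbhd_def by blast
qed

lemma istopology_skorohod_open: "istopology skorohod_open"
  unfolding istopology_def
proof (intro conjI allI impI)
  fix S U assume S: "skorohod_open S" and U: "skorohod_open U"
  show "skorohod_open (S \<inter> U)"
    unfolding skorohod_open_def
  proof (intro conjI ballI)
    show "S \<inter> U \<subseteq> Collect cadlag" using S by (auto simp: skorohod_open_def)
    fix x assume x: "x \<in> S \<inter> U"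
    obtain T e where 1: "e > 0" "skorohod_nbhd x T e \<subseteq> S"
      using S x unfolding skorohod_open_def by blast
    obtain T' e' where 2: "e' > 0" "skorohod_nbhd x T' e' \<subseteq> U"
      using U x unfolding skorohod_open_def by blast
    have "skorohod_nbhd x (max T T') (min e e') \<subseteq> S \<inter> U"
      using skorohod_nbhd_mono[of T "max T T'" "min e e'" e x]
        skorohod_nbhd_mono[of T' "max T T'" "min e e'" e' x] 1 2 by auto
    moreover have "min e e' > 0" using 1 2 by simp
    ultimately show "\<exists>T. \<exists>e>0. skorohod_nbhd x T e \<subseteq> S \<inter> U" by blast
  qed
next
  fix K assume K: "\<forall>S\<in>K. skorohod_open S"
  show "skorohod_open (\<Union>K)"
    unfolding skorohod_open_def
  proof (intro conjI ballI)
    show "\<Union>K \<subseteq> Collect cadlag" using K by (auto simp: skorohod_open_def)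
    fix x assume "x \<in> \<Union>K"
    then obtain S where "S \<in> K" "x \<in> S" by blast
    then show "\<exists>T. \<exists>e>0. skorohod_nbhd x T e \<subseteq> \<Union>K"
      using K unfolding skorohod_open_def by (meson Union_upper order_trans)
  qed
qed

lemma openin_skorohod_topology: "openin skorohod_topology U \<longleftrightarrow> skorohod_open U"
  by (simp add: skorohod_topology_def istopology_skorohod_open)

lemma topspace_skorohod_topology: "topspace skorohod_topology = Collect cadlag"
proof -
  have "skorohod_open (Collect cadlag)"
    unfolding skorohod_open_def skorohod_nbhd_def using zero_less_one by blast
  then show ?thesis
    unfolding topspace_def openin_skorohod_topology by (auto simp: skorohod_open_def)
qed


section \<open>Convergence in distribution\<close>

text \<open>The random elements $X_c$ on $M$ converge in law, along the filter $F$, to the random element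
  $Y$ on $N$. The expectations are taken with respect to the completed measures, because the
  hitting time of a closed set by a cadlag process is in general measurable only with respect to
  the completion; for random elements that are measurable without completion nothing changes.\<close>

definition converges_in_law ::
  "'x topology \<Rightarrow> 'c filter \<Rightarrow> 'm measure \<Rightarrow> ('c \<Rightarrow> 'm \<Rightarrow> 'x) \<Rightarrow> 'n measure \<Rightarrow> ('n \<Rightarrow> 'x) \<Rightarrow> bool" where
  "converges_in_law S F M X N Y \<longleftrightarrow>
     (\<forall>f :: 'x \<Rightarrow> real. continuous_map S euclideanreal f \<and> bounded (f ` topspace S) \<longrightarrow>
        ((\<lambda>c. \<integral>\<omega>. f (X c \<omega>) \<partial>completion M) \<longlongrightarrow> (\<integral>\<omega>. f (Y \<omega>) \<partial>completion N)) F)"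


section \<open>Stable processes\<close>

definition cadlag_process :: "'m measure \<Rightarrow> (real \<Rightarrow> 'm \<Rightarrow> 'a::euclidean_space) \<Rightarrow> bool" where
  "cadlag_process M X \<longleftrightarrow>
     (\<forall>t\<ge>0. X t \<in> borel_measurable M) \<and> (\<forall>\<omega>\<in>space M. cadlag (\<lambda>t. X t \<omega>))"

definition stationary_increments :: "'m measure \<Rightarrow> (real \<Rightarrow> 'm \<Rightarrow> 'a::euclidean_space) \<Rightarrow> bool" where
  "stationary_increments M X \<longleftrightarrow>
     (\<forall>s\<ge>0. \<forall>h\<ge>0. distr M borel (\<lambda>\<omega>. X (s + h) \<omega> - X s \<omega>) = distr M borel (\<lambda>\<omega>. X h \<omega> - X 0 \<omega>))"

definition independent_increments :: "'m measure \<Rightarrow> (real \<Rightarrow> 'm \<Rightarrow> 'a::euclidean_space) \<Rightarrow> bool" where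
  "independent_increments M X \<longleftrightarrow>
     (\<forall>(n::nat) (t :: nat \<Rightarrow> real). 0 \<le> t 0 \<and> (\<forall>i<n. t i \<le> t (Suc i)) \<longrightarrow>
        prob_space.indep_vars M (\<lambda>_. borel) (\<lambda>i \<omega>. X (t (Suc i)) \<omega> - X (t i) \<omega>) {..<n})"

text \<open>An isotropic stable process of index $\alpha$, with characteristic exponent
  $k |\lambda|^\alpha$.\<close>

definition isotropic_stable_process ::
  "'m measure \<Rightarrow> real \<Rightarrow> real \<Rightarrow> (real \<Rightarrow> 'm \<Rightarrow> 'a::euclidean_space) \<Rightarrow> bool" where
  "isotropic_stable_process M \<alpha> k X \<longleftrightarrow>
     cadlag_process M X \<and> stationary_increments M X \<and> independent_increments M X \<and>
     (\<forall>t\<ge>0. \<forall>v::'a. (\<integral>\<omega>. iexp (v \<bullet> (X t \<omega> - X 0 \<omega>)) \<partial>M)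
        = complex_of_real (exp (- t * k * norm v powr \<alpha>)))"

definition standard_planar_stable_from_1 :: "'m measure \<Rightarrow> real \<Rightarrow> (real \<Rightarrow> 'm \<Rightarrow> complex) \<Rightarrow> bool" where
  "standard_planar_stable_from_1 M \<alpha> Z \<longleftrightarrow>
     isotropic_stable_process M \<alpha> 1 Z \<and> (AE \<omega> in M. Z 0 \<omega> = 1)"

definition symmetric_stable_process :: "'m measure \<Rightarrow> real \<Rightarrow> (real \<Rightarrow> 'm \<Rightarrow> real) \<Rightarrow> bool" where
  "symmetric_stable_process M \<alpha> X \<longleftrightarrow>
     (\<exists>k>0. isotropic_stable_process M \<alpha> k X) \<and> (AE \<omega> in M. X 0 \<omega> = 0)"


section \<open>The winding process\<close>

definition left_value :: "(real \<Rightarrow> 'a::t2_space) \<Rightarrow> real \<Rightarrow> 'a" where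
  "left_value z s = (if s = 0 then z 0 else Lim (at_left s) z)"

text \<open>\<open>g\<close> is a parametrization on $[0,1]$ of the path of \<open>z\<close> on $[0,t]$ with its jumps filled in:
  \<open>r u\<close> is the time reached at parameter \<open>u\<close>, and on each interval where \<open>r\<close> takes a constant
  value \<open>s\<close>, the curve \<open>g\<close> runs monotonically along the segment from the left limit of \<open>z\<close> at
  \<open>s\<close> to \<open>z s\<close>. That \<open>g\<close> starts in \<open>z 0\<close> and covers the whole segment follows from continuity.\<close>

definition completed_curve :: "(real \<Rightarrow> complex) \<Rightarrow> real \<Rightarrow> (real \<Rightarrow> complex) \<Rightarrow> bool" where
  "completed_curve z t g \<longleftrightarrow>
     path g \<and> pathfinish g = z t \<and>
     (\<exists>r :: real \<Rightarrow> real. continuous_on {0..1} r \<and> mono_on {0..1} r \<and> r 0 = 0 \<and> r 1 = t \<and>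
        (\<forall>u\<in>{0..1}. g u \<in> closed_segment (left_value z (r u)) (z (r u))) \<and>
        (\<forall>u\<in>{0..1}. \<forall>v\<in>{u..1}. r u = r v \<longrightarrow> g v \<in> closed_segment (g u) (z (r v))))"

text \<open>For a curve that need not be closed, the total angle it winds around $0$ is $2\pi$ times the
  real part of \<^const>\<open>winding_number\<close>; the imaginary part records the change of modulus.
  That the completed curve avoids $0$ holds only almost surely; on a null set the paths of
  \<open>\<theta>\<close> are arbitrary cadlag functions.\<close>

definition winding_process ::
  "'m measure \<Rightarrow> (real \<Rightarrow> 'm \<Rightarrow> complex) \<Rightarrow> (real \<Rightarrow> 'm \<Rightarrow> real) \<Rightarrow> bool" where
  "winding_process M Z \<theta> \<longleftrightarrow>
     cadlag_process M \<theta> \<and>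
     (AE \<omega> in M. \<forall>t\<ge>0. \<exists>g. completed_curve (\<lambda>s. Z s \<omega>) t g \<and> 0 \<notin> path_image g \<and>
        \<theta> t \<omega> = 2 * pi * Re (winding_number g 0))"


section \<open>Passage times\<close>

text \<open>The first time a path reaches or exceeds a level $x \in (0,\infty]$. For a process with jumps
  this differs from the first time the path equals $x$, since the level is typically jumped over.\<close>

definition first_passage :: "ereal \<Rightarrow> (real \<Rightarrow> real) \<Rightarrow> ennreal" where
  "first_passage x f = Inf {ennreal t | t. 0 \<le> t \<and> x \<le> ereal (f t)}"

definition exit_time :: "ereal \<Rightarrow> ereal \<Rightarrow> (real \<Rightarrow> real) \<Rightarrow> ennreal" where
  "exit_time y x f = Inf {ennreal t | t. 0 \<le> t \<and> ereal (f t) \<notin> {- y<..<x}}"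

lemma exit_time_one_sided: "exit_time \<infinity> x f = first_passage x f"
  by (simp add: exit_time_def first_passage_def not_less)

lemma exit_time_symmetric: "exit_time x x f = first_passage x (\<lambda>t. \<bar>f t\<bar>)"
proof -
  have "ereal r \<notin> {- x<..<x} \<longleftrightarrow> x \<le> ereal \<bar>r\<bar>" for r
    by (cases x) auto
  then show ?thesis by (simp only: exit_time_def first_passage_def)
qed

end

theory Submission
  imports Defs
begin

text \<open>Put $Y_c(t) = c^{-1/\alpha} \theta_{ct}$. Up to the factor $1/c$ the times in question are times at which
  $Y_c$ leaves an interval $(-b,a)$, or equivalently at which $g \circ Y_c$ reaches the level $1$, where
  $g$ is the gauge of the interval: a Lipschitz and positively homogeneous function. As $Y_c$
  converges in law to $\zeta$, the claim would follow from the continuous mapping theorem if the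
  passage time $T$ were a continuous functional of the path. It is not, since a path may touch a
  level without crossing it, and the issue is to show that $\zeta$ does not do so with positive
  probability.

  The proof works with $e^{-\beta T} = \sup_t e^{-\beta t} 1_{[1,\infty)}(g(y_t))$. Replacing the indicator by a
  ramp turns this into a functional that is continuous in the Skorohod topology
  (\<open>discounted_sup_skorohod_continuous\<close>), and ramps to the left and to the right of $1$ enclose
  $e^{-\beta T}$ between two such functionals. Their expectations converge, and the gap between the two
  limits tends to $0$ by self-similarity. Indeed $Y_{kc}(t) = k^{-1/\alpha} Y_c(kt)$, so that in the limit
  raising the levels by the factor $k^{1/\alpha}$ amounts to replacing $\beta$ by $\beta k$, which changes
  $e^{-\beta T}$ by at most $k - 1$. This gives the convergence of the Laplace transforms of the passage
  times (in the proof of \<open>first_passage_converges_in_law\<close>), and these determine the law on $[0,\infty]$ because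
  they contain all moments of $e^{-T}$ (\<open>converges_in_law_ennreal_if_discounts_converge\<close>).

  The passage times themselves have to be measurable with respect to the completed measure, which
  for processes with jumps is a projection theorem. Here it is derived from Lusin's theorem on the
  Souslin operation (\<open>souslin_operation_measurable\<close>), since a right-continuous path is at or above
  a level at time $s$ iff it is nearly so along some sequence of rational times decreasing to $s$.\<close>

section \<open>Measurability of sets obtained by the Souslin operation\<close>

text \<open>A measurable hull of $A$ and a countable union of measurable subsets of $A$ then have the same
  finite measure, so that $A$ lies between two measurable sets that differ by a null set.\<close>

lemma sets_completion_if_approximable_from_inside:
  assumes "A \<subseteq> space M" "outer_measure_of M A < \<infinity>"
    and inner: "\<And>c. c < outer_measure_of M A \<Longrightarrow> \<exists>K\<in>sets M. K \<subseteq> A \<and> c \<le> emeasure M K"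
  shows "A \<in> sets (completion M)"
proof -
  obtain E where E: "E \<in> sets M" "A \<subseteq> E" "outer_measure_of M A = emeasure M E"
    using outer_measure_of_attain[OF assms(1)] by blast
  define \<K> where "\<K> = {K \<in> sets M. K \<subseteq> A}"
  have "\<K> \<noteq> {}" by (auto simp: \<K>_def)
  from ennreal_SUP_countable_SUP[OF this, of "emeasure M"]
  obtain f :: "nat \<Rightarrow> ennreal" where f: "range f \<subseteq> emeasure M ` \<K>" "Sup (emeasure M ` \<K>) = Sup (range f)"
    by blast
  then have "\<forall>n. \<exists>K\<in>\<K>. f n = emeasure M K" by blast
  then obtain K where K: "\<And>n. K n \<in> \<K>" "\<And>n. f n = emeasure M (K n)" by metis
  define K' where "K' = (\<Union>n. K n)"
  have K': "K' \<in> sets M" "K' \<subseteq> A" using K(1) by (auto simp: K'_def \<K>_def)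
  have "emeasure M E \<le> Sup (emeasure M ` \<K>)"
  proof (rule dense_le)
    fix c assume "c < emeasure M E"
    then obtain L where "L \<in> \<K>" "c \<le> emeasure M L" using inner E(3) by (auto simp: \<K>_def)
    then show "c \<le> Sup (emeasure M ` \<K>)" by (meson SUP_upper2)
  qed
  also have "\<dots> \<le> emeasure M K'"
    unfolding f(2) using K' by (auto intro!: SUP_least emeasure_mono simp: K(2) K'_def)
  finally have "emeasure M E \<le> emeasure M K'" .
  moreover have "emeasure M (E - K') = emeasure M E - emeasure M K'"
    using E K' assms(2) emeasure_mono[of K' E M]
    by (intro emeasure_Diff) (auto simp: top_unique)
  moreover have "emeasure M E < top" using E(3) assms(2) by simp
  ultimately have "emeasure M (E - K') = 0" by (simp add: diff_eq_0_ennreal)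
  then have "E - K' \<in> null_sets M"
    using E K' by (simp add: null_sets_def)
  then show ?thesis
    using K' E(2) by (intro sets_completionI[of A K' "A - K'" "E - K'"]) auto
qed

text \<open>The tree of admissible lists branches finitely because of the bound \<open>h\<close>. A list is \<open>good\<close> if
  it has admissible extensions of every length. By the pigeonhole principle one of its finitely
  many children is good again, and following good children yields the infinite branch.\<close>

lemma koenig_bounded_branching:
  fixes P :: "nat list \<Rightarrow> bool" and h :: "nat \<Rightarrow> nat"
  assumes "\<And>m. \<exists>xs. length xs = m \<and> (\<forall>i<m. xs ! i \<le> h i) \<and> (\<forall>j\<le>m. P (take j xs))"
  shows "\<exists>\<sigma>. \<forall>n. P (map \<sigma> [0..<n])"
proof -
  define ext where "ext m xs ys \<longleftrightarrow> length ys = m \<and> take (length xs) ys = xs \<and>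
      (\<forall>i<m. ys ! i \<le> h i) \<and> (\<forall>j\<le>m. P (take j ys))" for m xs ys
  define good where "good xs \<longleftrightarrow> (\<forall>m\<ge>length xs. \<exists>ys. ext m xs ys)" for xs
  have good_Nil: "good []" using assms by (simp add: good_def ext_def)
  have good_step: "\<exists>k. good (xs @ [k])" if "good xs" for xs
  proof (rule ccontr)
    assume "\<nexists>k. good (xs @ [k])"
    then have "\<forall>k. \<exists>m\<ge>Suc (length xs). \<nexists>ys. ext m (xs @ [k]) ys" by (auto simp: good_def)
    then obtain m where m: "\<And>k. m k \<ge> Suc (length xs)" "\<And>k ys. \<not> ext (m k) (xs @ [k]) ys" by metis
    define N where "N = Max (m ` {..h (length xs)})"
    have N: "m k \<le> N" if "k \<le> h (length xs)" for k
      unfolding N_def using that by (intro Max_ge) auto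
    have "N \<ge> Suc (length xs)" using N[of 0] m(1)[of 0] by simp
    then obtain ys where ys: "ext N xs ys" using \<open>good xs\<close> unfolding good_def by (meson Suc_leD)
    define k where "k = ys ! length xs"
    have k: "k \<le> h (length xs)" using ys \<open>N \<ge> Suc (length xs)\<close> by (simp add: ext_def k_def)
    have "take (Suc (length xs)) ys = xs @ [k]"
      using ys \<open>N \<ge> Suc (length xs)\<close> by (simp add: ext_def k_def take_Suc_conv_app_nth)
    then have "ext (m k) (xs @ [k]) (take (m k) ys)"
      using ys N[OF k] m(1)[of k] by (auto simp: ext_def min_def)
    then show False using m(2) by blast
  qed
  have "\<exists>X. \<forall>n. (good (X n) \<and> length (X n) = n) \<and> (\<exists>k. X (Suc n) = X n @ [k])"
  proof (rule dependent_nat_choice)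
    show "\<exists>xs. good xs \<and> length xs = 0" using good_Nil by auto
    fix xs n assume "good xs \<and> length xs = n"
    then show "\<exists>ys. (good ys \<and> length ys = Suc n) \<and> (\<exists>k. ys = xs @ [k])"
      using good_step[of xs] by auto
  qed
  then obtain X where X: "\<And>n. good (X n) \<and> length (X n) = n" "\<And>n. \<exists>k. X (Suc n) = X n @ [k]"
    by blast
  define \<sigma> where "\<sigma> i = X (Suc i) ! i" for i
  have eq: "X n = map \<sigma> [0..<n]" for n
  proof (induction n)
    case 0
    then show ?case using X(1)[of 0] by simp
  next
    case (Suc n)
    obtain k where "X (Suc n) = X n @ [k]" using X(2) by blast
    moreover from this have "\<sigma> n = k" using X(1)[of n] by (simp add: \<sigma>_def nth_append)
    ultimately show ?case using Suc by simp
  qed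
  have "P (X n)" for n
  proof -
    have "\<exists>ys. ext n (X n) ys" using X(1)[of n] by (auto simp: good_def)
    then show ?thesis using X(1)[of n] by (auto simp: ext_def)
  qed
  then show ?thesis using eq by metis
qed

text \<open>Lusin's theorem. The set $A$ is a projection along uncountably many sequences $\sigma$, but it can
  be exhausted by restricting the sequences to $\sigma_i \le h_i$. Since the outer measure is continuous
  along increasing unions of arbitrary sets, the bounds $h_0, h_1, \dots$ can be chosen one after the
  other without letting the outer measure drop to a given \<open>c\<close> below that of $A$. Below such
  bounds only finitely many initial segments of each length remain, which gives measurable sets
  \<open>C m\<close> of measure at least \<open>c\<close>, and Koenig's lemma places their intersection inside $A$.\<close>

theorem souslin_operation_measurable:
  fixes B :: "nat list \<Rightarrow> 'a set"
  assumes "finite_measure M" and B: "\<And>xs. B xs \<in> sets M"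
  shows "{\<omega>. \<exists>\<sigma>. \<forall>n. \<omega> \<in> B (map \<sigma> [0..<n])} \<in> sets (completion M)"
proof -
  interpret finite_measure M by fact
  define A where "A m h = {\<omega>. \<exists>\<sigma>. (\<forall>i<m. \<sigma> i \<le> h i) \<and> (\<forall>n. \<omega> \<in> B (map \<sigma> [0..<n]))}"
    for m :: nat and h :: "nat \<Rightarrow> nat"
  have A_space: "A m h \<subseteq> space M" for m h
  proof
    fix \<omega> assume "\<omega> \<in> A m h"
    then have "\<omega> \<in> B []" unfolding A_def by (auto dest: spec[of _ 0])
    then show "\<omega> \<in> space M" using B sets.sets_into_space by blast
  qed
  have fin: "outer_measure_of M (A m h) < \<infinity>" for m h
  proof -
    have "outer_measure_of M (A m h) \<le> emeasure M (space M)"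
      using outer_measure_of_mono[OF A_space, of M m h] by simp
    also have "\<dots> < \<infinity>" using emeasure_finite[of "space M"] by (simp add: less_top[symmetric])
    finally show ?thesis .
  qed
  have "A 0 (\<lambda>_. 0) \<in> sets (completion M)"
  proof (rule sets_completion_if_approximable_from_inside[OF A_space fin])
    fix c assume c: "c < outer_measure_of M (A 0 (\<lambda>_. 0))"
    have step: "\<exists>k. c < outer_measure_of M (A (Suc n) (g(n := k)))"
      if "c < outer_measure_of M (A n g)" for n g
    proof -
      have "A n g = (\<Union>k. A (Suc n) (g(n := k)))"
      proof safe
        fix \<omega> assume "\<omega> \<in> A n g"
        then obtain \<sigma> where "\<forall>i<n. \<sigma> i \<le> g i" "\<forall>n. \<omega> \<in> B (map \<sigma> [0..<n])"
          by (auto simp: A_def)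
        then have "\<omega> \<in> A (Suc n) (g(n := \<sigma> n))" by (auto simp: A_def less_Suc_eq)
        then show "\<omega> \<in> (\<Union>k. A (Suc n) (g(n := k)))" by blast
      next
        fix \<omega> k assume "\<omega> \<in> A (Suc n) (g(n := k))"
        then obtain \<sigma> where \<sigma>: "\<forall>i<Suc n. \<sigma> i \<le> (g(n := k)) i" "\<forall>n. \<omega> \<in> B (map \<sigma> [0..<n])"
          by (auto simp: A_def)
        have "\<sigma> i \<le> g i" if "i < n" for i using \<sigma>(1)[rule_format, of i] that by simp
        then show "\<omega> \<in> A n g" using \<sigma>(2) by (auto simp: A_def)
      qed
      moreover have "incseq (\<lambda>k. A (Suc n) (g(n := k)))"
      proof (rule incseq_SucI, rule subsetI)
        fix k \<omega> assume "\<omega> \<in> A (Suc n) (g(n := k))"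
        then obtain \<sigma> where \<sigma>: "\<forall>i<Suc n. \<sigma> i \<le> (g(n := k)) i" "\<forall>n. \<omega> \<in> B (map \<sigma> [0..<n])"
          by (auto simp: A_def)
        have "\<sigma> i \<le> (g(n := Suc k)) i" if "i < Suc n" for i
          using \<sigma>(1)[rule_format, of i] that by (auto split: if_splits)
        then show "\<omega> \<in> A (Suc n) (g(n := Suc k))"
          using \<sigma>(2) unfolding A_def by (intro CollectI exI[of _ \<sigma>] conjI) simp_all
      qed
      ultimately have "outer_measure_of M (A n g) = (SUP k. outer_measure_of M (A (Suc n) (g(n := k))))"
        using A_space by (simp add: SUP_outer_measure_of_incseq)
      then show ?thesis using that by (simp add: less_SUP_iff)
    qed
    have "\<exists>f. \<forall>n. c < outer_measure_of M (A n (f n)) \<and> (\<exists>k. f (Suc n) = (f n)(n := k))"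
    proof (rule dependent_nat_choice)
      show "\<exists>g. c < outer_measure_of M (A 0 g)" using c by blast
      show "\<exists>g'. c < outer_measure_of M (A (Suc n) g') \<and> (\<exists>k. g' = g(n := k))"
        if "c < outer_measure_of M (A n g)" for g n
        using step[OF that] by blast
    qed
    then obtain f where f: "\<And>n. c < outer_measure_of M (A n (f n))" "\<And>n. \<exists>k. f (Suc n) = (f n)(n := k)"
      by blast
    define h where "h i = f (Suc i) i" for i
    have f_eq: "f n i = h i" if "i < n" for n i
      using that
    proof (induction n)
      case (Suc n)
      obtain k where "f (Suc n) = (f n)(n := k)" using f(2) by blast
      then show ?case using Suc by (cases "i = n") (auto simp: h_def)
    qed simp
    define Xs where "Xs m = {xs :: nat list. length xs = m \<and> (\<forall>i<m. xs ! i \<le> h i)}" for m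
    have fin_Xs: "finite (Xs m)" for m
    proof (rule finite_subset)
      have "xs ! i \<le> (\<Sum>i<m. h i)" if "xs \<in> Xs m" "i < m" for xs i
      proof -
        have "xs ! i \<le> h i" using that by (simp add: Xs_def)
        also have "\<dots> \<le> (\<Sum>i<m. h i)" using that(2) by (intro member_le_sum) auto
        finally show ?thesis .
      qed
      then show "Xs m \<subseteq> {xs. set xs \<subseteq> {..\<Sum>i<m. h i} \<and> length xs = m}"
        by (auto simp: in_set_conv_nth Xs_def)
    qed (simp add: finite_lists_length_eq)
    define C where "C m = (\<Union>xs\<in>Xs m. \<Inter>j\<in>{..m}. B (take j xs))" for m
    have C_sets: "C m \<in> sets M" for m
      unfolding C_def using B fin_Xs by (intro sets.finite_UN sets.finite_INT) auto
    have "C (Suc m) \<subseteq> C m" for m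
    proof
      fix \<omega> assume "\<omega> \<in> C (Suc m)"
      then obtain xs where xs: "xs \<in> Xs (Suc m)" "\<And>j. j \<le> Suc m \<Longrightarrow> \<omega> \<in> B (take j xs)"
        by (auto simp: C_def)
      then have "take m xs \<in> Xs m" by (auto simp: Xs_def)
      moreover have "\<omega> \<in> B (take j (take m xs))" if "j \<le> m" for j
        using xs(2)[of j] that by (simp add: min_absorb1)
      ultimately show "\<omega> \<in> C m" unfolding C_def by blast
    qed
    then have dec: "decseq C" by (rule decseq_SucI)
    have le: "c \<le> emeasure M (C m)" for m
    proof -
      have "A m (f m) \<subseteq> C m"
      proof
        fix \<omega> assume "\<omega> \<in> A m (f m)"
        then obtain \<sigma> where \<sigma>: "\<forall>i<m. \<sigma> i \<le> f m i" "\<And>n. \<omega> \<in> B (map \<sigma> [0..<n])"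
          by (auto simp: A_def)
        then have "map \<sigma> [0..<m] \<in> Xs m" by (auto simp: Xs_def f_eq)
        moreover have "\<omega> \<in> B (take j (map \<sigma> [0..<m]))" if "j \<le> m" for j
          using \<sigma>(2)[of j] that by (simp add: take_map)
        ultimately show "\<omega> \<in> C m" unfolding C_def by blast
      qed
      then have "outer_measure_of M (A m (f m)) \<le> emeasure M (C m)"
        using outer_measure_of_mono[of "A m (f m)" "C m" M] C_sets by simp
      then show ?thesis using f(1)[of m] by simp
    qed
    show "\<exists>K\<in>sets M. K \<subseteq> A 0 (\<lambda>_. 0) \<and> c \<le> emeasure M K"
    proof (intro bexI conjI)
      show "(\<Inter>m. C m) \<in> sets M" using C_sets by auto
      have "emeasure M (\<Inter>m. C m) = (INF m. emeasure M (C m))"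
        using C_sets dec by (intro INF_emeasure_decseq[symmetric]) auto
      then show "c \<le> emeasure M (\<Inter>m. C m)" using le by (auto intro: INF_greatest)
      show "(\<Inter>m. C m) \<subseteq> A 0 (\<lambda>_. 0)"
      proof
        fix \<omega> assume \<omega>: "\<omega> \<in> (\<Inter>m. C m)"
        have "\<exists>xs. length xs = m \<and> (\<forall>i<m. xs ! i \<le> h i) \<and> (\<forall>j\<le>m. \<omega> \<in> B (take j xs))" for m
        proof -
          have "\<omega> \<in> C m" using \<omega> by blast
          then obtain xs where "xs \<in> Xs m" "\<forall>j\<le>m. \<omega> \<in> B (take j xs)" unfolding C_def by blast
          then show ?thesis unfolding Xs_def by blast
        qed
        from koenig_bounded_branching[of h "\<lambda>xs. \<omega> \<in> B xs", OF this]
        show "\<omega> \<in> A 0 (\<lambda>_. 0)" by (simp add: A_def)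
      qed
    qed
  qed
  then show ?thesis by (simp add: A_def)
qed

section \<open>Measurability of first passage times\<close>

text \<open>A right-continuous path reaches the level \<open>x\<close> at time \<open>s\<close> iff its values along some rational
  times that decrease strictly to \<open>s\<close> have a limit of at least \<open>x\<close>. Decreasing sequences are needed
  because the left limit may exceed \<open>x\<close> at a time at which the path jumps below it. The condition
  on the sequence refers to two consecutive terms at a time, as the Souslin operation requires.\<close>

lemma reaches_level_iff_rational_sequence:
  fixes f :: "real \<Rightarrow> real" and y :: ennreal
  assumes rc: "\<And>t. t \<ge> 0 \<Longrightarrow> (f \<longlongrightarrow> f t) (at_right t)"
  shows "(\<exists>s\<ge>0. ennreal s < y \<and> x \<le> f s) \<longleftrightarrow>
    (\<exists>r :: nat \<Rightarrow> rat. \<forall>n. 0 < real_of_rat (r n) \<and> ennreal (of_rat (r n)) < y \<and>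
       real_of_rat (r (Suc n)) < of_rat (r n) \<and> x - 1 / Suc n < f (of_rat (r n)))"
proof (intro iffI; (elim exE conjE)?)
  fix s assume s: "0 \<le> s" "ennreal s < y" "x \<le> f s"
  have step: "\<exists>r. s < real_of_rat r \<and> of_rat r < u \<and> ennreal (of_rat r) < y \<and> x - 1 / Suc n < f (of_rat r)"
    if "s < u" for u n
  proof -
    have "((\<lambda>t. ennreal t) \<longlongrightarrow> ennreal s) (at_right s)" by (intro tendsto_intros)
    from order_tendstoD(2)[OF this s(2)] have "\<forall>\<^sub>F t in at_right s. ennreal t < y" .
    moreover have "x - 1 / Suc n < f s"
      using s(3) by (smt (verit, best) divide_pos_pos of_nat_0_less_iff zero_less_Suc zero_less_one)
    then have "\<forall>\<^sub>F t in at_right s. x - 1 / Suc n < f t"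
      using order_tendstoD(1)[OF rc[OF s(1)]] by blast
    moreover have "\<forall>\<^sub>F t in at_right s. t < u"
      using that eventually_at_right_field by blast
    ultimately have "\<forall>\<^sub>F t in at_right s. ennreal t < y \<and> x - 1 / Suc n < f t \<and> t < u"
      by eventually_elim auto
    then obtain b where "b > s" "\<And>t. s < t \<Longrightarrow> t < b \<Longrightarrow> ennreal t < y \<and> x - 1 / Suc n < f t \<and> t < u"
      unfolding eventually_at_right_field by blast
    then show ?thesis using of_rat_dense[of s b] by blast
  qed
  have "\<exists>r. \<forall>n. (s < real_of_rat (r n) \<and> ennreal (of_rat (r n)) < y \<and> x - 1 / Suc n < f (of_rat (r n))) \<and>
      real_of_rat (r (Suc n)) < of_rat (r n)"
  proof (rule dependent_nat_choice)
    show "\<exists>r. s < real_of_rat r \<and> ennreal (of_rat r) < y \<and> x - 1 / real (Suc 0) < f (of_rat r)"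
      using step[of "s + 1" 0] by auto
    fix r n assume "s < real_of_rat r \<and> ennreal (of_rat r) < y \<and> x - 1 / real (Suc n) < f (of_rat r)"
    then show "\<exists>r'. (s < real_of_rat r' \<and> ennreal (of_rat r') < y \<and>
        x - 1 / real (Suc (Suc n)) < f (of_rat r')) \<and> real_of_rat r' < of_rat r"
      using step[of "of_rat r" "Suc n"] by auto
  qed
  then show "\<exists>r :: nat \<Rightarrow> rat. \<forall>n. 0 < real_of_rat (r n) \<and> ennreal (of_rat (r n)) < y \<and>
       real_of_rat (r (Suc n)) < of_rat (r n) \<and> x - 1 / Suc n < f (of_rat (r n))"
    using s(1) by (meson le_less_trans)
next
  fix r :: "nat \<Rightarrow> rat"
  define q where "q n = real_of_rat (r n)" for n
  assume "\<forall>n. 0 < real_of_rat (r n) \<and> ennreal (of_rat (r n)) < y \<and>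
       real_of_rat (r (Suc n)) < of_rat (r n) \<and> x - 1 / Suc n < f (of_rat (r n))"
  then have q: "\<And>n. 0 < q n" "\<And>n. ennreal (q n) < y" "\<And>n. q (Suc n) < q n"
    "\<And>n. x - 1 / Suc n < f (q n)"
    by (auto simp: q_def)
  have "decseq q" using q(3) by (intro decseq_SucI less_imp_le)
  moreover have "bdd_below (range q)" using q(1) by (intro bdd_belowI2[of _ 0]) (auto intro: less_imp_le)
  ultimately obtain s where s: "q \<longlonglongrightarrow> s" "\<And>n. s \<le> q n"
    using decseq_convergent[of q 0] q(1) less_imp_le by metis
  have less: "s < q n" for n using s(2)[of "Suc n"] q(3)[of n] by simp
  have "s \<ge> 0" using s(1) q(1) by (intro LIMSEQ_le_const[of q]) (auto intro: less_imp_le)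
  have "filterlim q (at_right s) sequentially"
    unfolding filterlim_at using s(1) less by (auto intro!: always_eventually simp: less_imp_neq[symmetric])
  then have "(\<lambda>n. f (q n)) \<longlonglongrightarrow> f s"
    using rc[OF \<open>s \<ge> 0\<close>] filterlim_compose by blast
  moreover have "(\<lambda>n. x - 1 / Suc n) \<longlonglongrightarrow> x - 0"
    by (intro tendsto_intros LIMSEQ_Suc lim_inverse_n'[unfolded inverse_eq_divide])
  ultimately have "x \<le> f s"
    using q(4) LIMSEQ_le[of "\<lambda>n. x - 1 / Suc n" x "\<lambda>n. f (q n)" "f s"] by (auto intro: less_imp_le)
  moreover have "ennreal s < y" using less[of 0] q(2)[of 0] by (meson ennreal_leI le_less_trans less_imp_le)
  ultimately show "\<exists>s\<ge>0. ennreal s < y \<and> x \<le> f s" using \<open>s \<ge> 0\<close> by blast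
qed

lemma first_passage_less_iff:
  "first_passage x f < y \<longleftrightarrow> (\<exists>s\<ge>0. ennreal s < y \<and> x \<le> ereal (f s))"
  by (auto simp: first_passage_def Inf_less_iff)

text \<open>The event $\{T < y\}$ is an uncountable union over times, and for a process with jumps it cannot be
  reduced to rational times, since a level may be approached from the left without being reached.
  It results however from the Souslin operation, with the rational sequences above as branches.\<close>

lemma first_passage_measurable:
  fixes X :: "real \<Rightarrow> 'm \<Rightarrow> real" and x :: real
  assumes "finite_measure M" and X: "cadlag_process M X"
  shows "(\<lambda>\<omega>. first_passage x (\<lambda>t. X t \<omega>)) \<in> borel_measurable (completion M)"
proof (rule borel_measurableI_less)
  fix y :: ennreal
  define q :: "nat \<Rightarrow> real" where "q k = of_rat (from_nat k)" for k
  define chain where "chain ks \<longleftrightarrow> (\<forall>i<length ks. 0 < q (ks ! i) \<and> ennreal (q (ks ! i)) < y \<and>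
      (Suc i < length ks \<longrightarrow> q (ks ! Suc i) < q (ks ! i)))" for ks
  define B where "B ks = (if chain ks
      then {\<omega> \<in> space M. \<forall>i\<in>{..<length ks}. x - 1 / Suc i < X (q (ks ! i)) \<omega>} else {})" for ks
  have B_sets: "B ks \<in> sets M" for ks
  proof (cases "chain ks")
    case True
    have meas: "{\<omega> \<in> space M. x - 1 / Suc i < X (q (ks ! i)) \<omega>} \<in> sets M" if "i < length ks" for i
    proof -
      have [measurable]: "X (q (ks ! i)) \<in> borel_measurable M"
        using X True that by (auto simp: cadlag_process_def chain_def intro: less_imp_le)
      show ?thesis by measurable
    qed
    have "{\<omega> \<in> space M. \<forall>i\<in>{..<length ks}. x - 1 / Suc i < X (q (ks ! i)) \<omega>} \<in> sets M"
      using meas by (intro sets.sets_Collect_finite_All) auto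
    then show ?thesis by (simp add: B_def)
  qed (simp add: B_def)
  have "{\<omega> \<in> space (completion M). first_passage x (\<lambda>t. X t \<omega>) < y} =
      {\<omega>. \<exists>\<sigma>. \<forall>n. \<omega> \<in> B (map \<sigma> [0..<n])}"
  proof (rule set_eqI)
    fix \<omega>
    have B_iff: "(\<forall>n. \<omega> \<in> B (map \<sigma> [0..<n])) \<longleftrightarrow> \<omega> \<in> space M \<and> (\<forall>n. 0 < q (\<sigma> n) \<and> ennreal (q (\<sigma> n)) < y \<and>
          q (\<sigma> (Suc n)) < q (\<sigma> n) \<and> x - 1 / Suc n < X (q (\<sigma> n)) \<omega>)" (is "?L \<longleftrightarrow> ?R") for \<sigma>
    proof
      assume ?L
      have "\<omega> \<in> space M" using \<open>?L\<close>[rule_format, of 0] by (auto simp: B_def split: if_splits)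
      moreover have "0 < q (\<sigma> n) \<and> ennreal (q (\<sigma> n)) < y \<and>
          q (\<sigma> (Suc n)) < q (\<sigma> n) \<and> x - 1 / Suc n < X (q (\<sigma> n)) \<omega>" for n
      proof -
        have L: "\<omega> \<in> B (map \<sigma> [0..<Suc (Suc n)])" using \<open>?L\<close> by blast
        have ch: "chain (map \<sigma> [0..<Suc (Suc n)])" using L unfolding B_def by (metis empty_iff)
        have "0 < q (\<sigma> n) \<and> ennreal (q (\<sigma> n)) < y \<and> q (\<sigma> (Suc n)) < q (\<sigma> n)"
          using ch[unfolded chain_def, rule_format, of n] by (simp del: upt_Suc)
        moreover have "x - 1 / Suc n < X (q (\<sigma> n)) \<omega>"
          using L ch unfolding B_def by (simp del: upt_Suc)
        ultimately show ?thesis by simp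
      qed
      ultimately show ?R by blast
    next
      assume ?R
      then show ?L by (auto simp: B_def chain_def simp del: upt_Suc)
    qed
    show "\<omega> \<in> {\<omega> \<in> space (completion M). first_passage x (\<lambda>t. X t \<omega>) < y} \<longleftrightarrow>
        \<omega> \<in> {\<omega>. \<exists>\<sigma>. \<forall>n. \<omega> \<in> B (map \<sigma> [0..<n])}"
    proof (cases "\<omega> \<in> space M")
      case True
      have rc: "((\<lambda>t. X t \<omega>) \<longlongrightarrow> X t' \<omega>) (at_right t')" if "t' \<ge> 0" for t'
        using X True that by (auto simp: cadlag_process_def cadlag_def)
      let ?P = "\<lambda>r :: nat \<Rightarrow> rat. \<forall>n. 0 < real_of_rat (r n) \<and> ennreal (of_rat (r n)) < y \<and>
         real_of_rat (r (Suc n)) < of_rat (r n) \<and> x - 1 / Suc n < X (of_rat (r n)) \<omega>"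
      have "first_passage x (\<lambda>t. X t \<omega>) < y \<longleftrightarrow> (\<exists>r. ?P r)"
        using reaches_level_iff_rational_sequence[of "\<lambda>t. X t \<omega>" y x, OF rc]
        by (simp add: first_passage_less_iff)
      also have "\<dots> \<longleftrightarrow> (\<exists>\<sigma> :: nat \<Rightarrow> nat. ?P (\<lambda>n. from_nat (\<sigma> n)))"
      proof
        assume "\<exists>r. ?P r"
        then obtain r where "?P r" by blast
        then have "?P (\<lambda>n. from_nat (to_nat (r n)))" by simp
        then show "\<exists>\<sigma> :: nat \<Rightarrow> nat. ?P (\<lambda>n. from_nat (\<sigma> n))" by (rule exI[of _ "\<lambda>n. to_nat (r n)"])
      next
        assume "\<exists>\<sigma> :: nat \<Rightarrow> nat. ?P (\<lambda>n. from_nat (\<sigma> n))"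
        then obtain \<sigma> :: "nat \<Rightarrow> nat" where "?P (\<lambda>n. from_nat (\<sigma> n))" by blast
        then show "\<exists>r. ?P r" by (rule exI[of _ "\<lambda>n. from_nat (\<sigma> n)"])
      qed
      finally show ?thesis using True B_iff by (simp add: q_def)
    qed (use B_iff in auto)
  qed
  then show "{\<omega> \<in> space (completion M). first_passage x (\<lambda>t. X t \<omega>) < y} \<in> sets (completion M)"
    using souslin_operation_measurable[OF assms(1) B_sets] by simp
qed

section \<open>Laplace transforms and convergence in law on the extended half-line\<close>

text \<open>The value of $e^{-\beta T}$, extended to $T = \infty$ by its limit for $\beta > 0$.\<close>

definition discount :: "real \<Rightarrow> ennreal \<Rightarrow> real" where
  "discount \<beta> T = (if T = \<infinity> then 0 else exp (- \<beta> * enn2real T))"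

lemma discount_top [simp]: "discount \<beta> \<infinity> = 0" "discount \<beta> top = 0"
  by (simp_all add: discount_def)

lemma discount_ennreal [simp]: "t \<ge> 0 \<Longrightarrow> discount \<beta> (ennreal t) = exp (- \<beta> * t)"
  by (simp add: discount_def)

lemma discount_nonneg: "0 \<le> discount \<beta> T"
  by (simp add: discount_def)

lemma discount_le_1: "\<beta> \<ge> 0 \<Longrightarrow> discount \<beta> T \<le> 1"
  by (simp add: discount_def)

lemma discount_antimono: "0 \<le> \<beta> \<Longrightarrow> S \<le> T \<Longrightarrow> discount \<beta> T \<le> discount \<beta> S"
proof (cases "T = top")
  case False
  assume "0 \<le> \<beta>" "S \<le> T"
  have "S \<noteq> top" using \<open>S \<le> T\<close> False by (metis top_unique)
  moreover have "enn2real S \<le> enn2real T"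
    using \<open>S \<le> T\<close> False by (intro enn2real_mono) (simp_all add: less_top[symmetric])
  ultimately show ?thesis using False \<open>0 \<le> \<beta>\<close> by (simp add: discount_def mult_left_mono)
qed (simp add: discount_nonneg)

lemma discount_power: "n > 0 \<Longrightarrow> discount (real n) T = discount 1 T ^ n"
  by (simp add: discount_def exp_of_nat_mult[symmetric])

lemma measurable_discount [measurable]: "discount \<beta> \<in> borel_measurable borel"
  unfolding discount_def by measurable

definition inverse_discount :: "real \<Rightarrow> ennreal" where
  "inverse_discount u = (if u = 0 then \<infinity> else ennreal (- ln u))"

lemma inverse_discount_discount: "inverse_discount (discount 1 T) = T"
  by (cases T) (simp_all add: inverse_discount_def)

lemma continuous_on_inverse_discount: "continuous_on {0..1} inverse_discount"
  unfolding continuous_on_def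
proof
  fix u :: real assume u: "u \<in> {0..1}"
  show "(inverse_discount \<longlongrightarrow> inverse_discount u) (at u within {0..1})"
  proof (cases "u = 0")
    case True
    have "LIM v at_right (0::real). - ln v :> at_top"
      using ln_at_0 by (simp add: filterlim_uminus_at_top)
    then have "((\<lambda>v. ennreal (- ln v)) \<longlongrightarrow> \<infinity>) (at_right 0)"
      by (simp add: ennreal_tendsto_top_eq_at_top)
    then have "(inverse_discount \<longlongrightarrow> \<infinity>) (at_right 0)"
      by (rule Lim_transform_eventually) (auto simp: eventually_at_filter inverse_discount_def)
    then show ?thesis
      using True by (auto simp: inverse_discount_def at_within_Icc_at_right)
  next
    case False
    then have "((\<lambda>v. ennreal (- ln v)) \<longlongrightarrow> ennreal (- ln u)) (at u within {0..1})"
      by (intro tendsto_intros) auto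
    moreover have "\<forall>\<^sub>F v in at u within {0..1}. ennreal (- ln v) = inverse_discount v"
      using tendsto_ident_at False unfolding inverse_discount_def
      by (auto simp: eventually_at_filter intro!: eventually_mono[OF t1_space_nhds])
    ultimately show ?thesis
      using False by (auto simp: inverse_discount_def intro: Lim_transform_eventually)
  qed
qed

text \<open>On the unit interval moments determine the law, because polynomials approximate continuous
  functions uniformly.\<close>

lemma convergence_of_moments_imp_integral:
  fixes U :: "'c \<Rightarrow> 'm \<Rightarrow> real" and V :: "'n \<Rightarrow> real" and g :: "real \<Rightarrow> real"
  assumes M: "prob_space M" and N: "prob_space N"
    and U: "\<forall>\<^sub>F c in F. U c \<in> borel_measurable M" "\<And>c \<omega>. U c \<omega> \<in> {0..1}"
    and V: "V \<in> borel_measurable N" "\<And>\<omega>. V \<omega> \<in> {0..1}"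
    and moments: "\<And>n. n > 0 \<Longrightarrow> ((\<lambda>c. \<integral>\<omega>. U c \<omega> ^ n \<partial>M) \<longlongrightarrow> (\<integral>\<omega>. V \<omega> ^ n \<partial>N)) F"
    and g: "continuous_on {0..1} g"
  shows "((\<lambda>c. \<integral>\<omega>. g (U c \<omega>) \<partial>M) \<longlongrightarrow> (\<integral>\<omega>. g (V \<omega>) \<partial>N)) F"
proof -
  interpret M: prob_space M by fact
  interpret N: prob_space N by fact
  have g_meas: "(\<lambda>\<omega>. g (W \<omega>)) \<in> borel_measurable K"
    if "W \<in> borel_measurable K" "\<And>\<omega>. W \<omega> \<in> {0..1}" for W :: "'z \<Rightarrow> real" and K
  proof -
    have "(\<lambda>x. if x \<in> {0..1} then g x else 0) \<in> borel_measurable borel"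
      by (rule borel_measurable_continuous_on_if) (use g in auto)
    from measurable_compose[OF that(1) this] show ?thesis using that(2) by simp
  qed
  obtain B where B: "\<And>u. u \<in> {0..1} \<Longrightarrow> \<bar>g u\<bar> \<le> B"
    using compact_continuous_image[OF g compact_Icc, THEN compact_imp_bounded]
    unfolding bounded_iff by (force simp: ball_simps)
  have int_pow: "integrable K (\<lambda>\<omega>. W \<omega> ^ n)" and int_g: "integrable K (\<lambda>\<omega>. g (W \<omega>))"
    if "prob_space K" "W \<in> borel_measurable K" "\<And>\<omega>. W \<omega> \<in> {0..1}" for W :: "'z \<Rightarrow> real" and K n
  proof -
    interpret K: prob_space K by fact
    show "integrable K (\<lambda>\<omega>. W \<omega> ^ n)"
      using that(2,3) by (intro K.integrable_const_bound[where B = 1]) (auto intro!: power_le_one)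
    show "integrable K (\<lambda>\<omega>. g (W \<omega>))"
      using g_meas[OF that(2,3)] that(3) B by (intro K.integrable_const_bound[where B = B]) auto
  qed
  have approx: "\<bar>(\<integral>\<omega>. g (W \<omega>) \<partial>K) - (\<Sum>i\<le>m. a i * (\<integral>\<omega>. W \<omega> ^ i \<partial>K))\<bar> \<le> e"
    if K: "prob_space K" "W \<in> borel_measurable K" "\<And>\<omega>. W \<omega> \<in> {0..1}"
      and a: "\<And>u. u \<in> {0..1} \<Longrightarrow> \<bar>g u - (\<Sum>i\<le>m. a i * u ^ i)\<bar> < e"
    for W :: "'z \<Rightarrow> real" and K and a :: "nat \<Rightarrow> real" and m e
  proof -
    interpret K: prob_space K by fact
    have "(\<integral>\<omega>. g (W \<omega>) \<partial>K) - (\<Sum>i\<le>m. a i * (\<integral>\<omega>. W \<omega> ^ i \<partial>K)) =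
        (\<integral>\<omega>. g (W \<omega>) - (\<Sum>i\<le>m. a i * W \<omega> ^ i) \<partial>K)"
      using int_pow[OF K] int_g[OF K] by (simp add: Bochner_Integration.integral_sum)
    also have "\<bar>\<dots>\<bar> \<le> (\<integral>\<omega>. \<bar>g (W \<omega>) - (\<Sum>i\<le>m. a i * W \<omega> ^ i)\<bar> \<partial>K)"
      by (rule integral_abs_bound)
    also have "\<dots> \<le> (\<integral>\<omega>. e \<partial>K)"
      using int_pow[OF K] int_g[OF K] a K(3)
      by (intro integral_mono) (auto intro!: less_imp_le)
    finally show ?thesis by (simp add: K.prob_space)
  qed
  show ?thesis
  proof (rule tendstoI)
    fix e :: real assume "e > 0"
    obtain p where p: "real_polynomial_function p" "\<And>u. u \<in> {0..1} \<Longrightarrow> \<bar>g u - p u\<bar> < e / 4"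
      using Stone_Weierstrass_real_polynomial_function[OF compact_Icc g, of "e / 4"] \<open>e > 0\<close> by auto
    obtain a m where a: "p = (\<lambda>u. \<Sum>i\<le>m. a i * u ^ i)"
      using p(1) real_polynomial_function_iff_sum by auto
    let ?S = "\<lambda>c. \<Sum>i\<le>m. a i * (\<integral>\<omega>. U c \<omega> ^ i \<partial>M)" and ?S' = "\<Sum>i\<le>m. a i * (\<integral>\<omega>. V \<omega> ^ i \<partial>N)"
    have mom: "((\<lambda>c. \<integral>\<omega>. U c \<omega> ^ i \<partial>M) \<longlongrightarrow> (\<integral>\<omega>. V \<omega> ^ i \<partial>N)) F" for i
      by (cases "i = 0") (use moments in \<open>auto simp: M.prob_space N.prob_space\<close>)
    have "(?S \<longlongrightarrow> ?S') F"
      by (intro tendsto_sum tendsto_mult tendsto_const mom)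
    then have "\<forall>\<^sub>F c in F. dist (?S c) ?S' < e / 4"
      using \<open>e > 0\<close> by (intro tendstoD) auto
    with U(1) show "\<forall>\<^sub>F c in F. dist (\<integral>\<omega>. g (U c \<omega>) \<partial>M) (\<integral>\<omega>. g (V \<omega>) \<partial>N) < e"
    proof eventually_elim
      case (elim c)
      have "\<bar>(\<integral>\<omega>. g (U c \<omega>) \<partial>M) - ?S c\<bar> \<le> e / 4"
        using p(2) unfolding a by (intro approx[OF M elim(1) U(2)]) auto
      moreover have "\<bar>(\<integral>\<omega>. g (V \<omega>) \<partial>N) - ?S'\<bar> \<le> e / 4"
        using p(2) unfolding a by (intro approx[OF N V]) auto
      ultimately show ?case using elim(2) \<open>e > 0\<close> unfolding dist_real_def by linarith
    qed
  qed
qed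

text \<open>The map $T \mapsto e^{-T}$ identifies $[0,\infty]$ with the unit interval, and the Laplace transform of
  $T$ at an integer $n$ is the $n$-th moment of $e^{-T}$.\<close>

lemma converges_in_law_ennreal_if_discounts_converge:
  fixes T :: "'c \<Rightarrow> 'm \<Rightarrow> ennreal" and T' :: "'n \<Rightarrow> ennreal"
  assumes "prob_space M" "prob_space N"
    and "\<forall>\<^sub>F c in F. T c \<in> borel_measurable (completion M)" "T' \<in> borel_measurable (completion N)"
    and "\<And>\<beta>. \<beta> > 0 \<Longrightarrow>
      ((\<lambda>c. \<integral>\<omega>. discount \<beta> (T c \<omega>) \<partial>completion M) \<longlongrightarrow> (\<integral>\<omega>. discount \<beta> (T' \<omega>) \<partial>completion N)) F"
  shows "converges_in_law euclidean F M T N T'"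
  unfolding converges_in_law_def
proof (intro allI impI)
  fix f :: "ennreal \<Rightarrow> real"
  assume "continuous_map euclidean euclideanreal f \<and> bounded (f ` topspace euclidean)"
  then have f: "continuous_on UNIV f" by simp
  let ?g = "\<lambda>u. f (inverse_discount u)"
  have g: "continuous_on {0..1} ?g"
    by (rule continuous_on_compose2[OF f continuous_on_inverse_discount]) auto
  have "((\<lambda>c. \<integral>\<omega>. ?g (discount 1 (T c \<omega>)) \<partial>completion M) \<longlongrightarrow>
      (\<integral>\<omega>. ?g (discount 1 (T' \<omega>)) \<partial>completion N)) F"
  proof (rule convergence_of_moments_imp_integral[OF _ _ _ _ _ _ _ g])
    show "prob_space (completion M)" "prob_space (completion N)"
      using assms(1,2) by (simp_all add: prob_space.prob_space_completion)
    show "\<forall>\<^sub>F c in F. (\<lambda>\<omega>. discount 1 (T c \<omega>)) \<in> borel_measurable (completion M)"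
      using assms(3) by eventually_elim measurable
    show "(\<lambda>\<omega>. discount 1 (T' \<omega>)) \<in> borel_measurable (completion N)"
      using assms(4) by measurable
  next
    fix n :: nat assume "n > 0"
    then show "((\<lambda>c. \<integral>\<omega>. discount 1 (T c \<omega>) ^ n \<partial>completion M) \<longlongrightarrow>
        (\<integral>\<omega>. discount 1 (T' \<omega>) ^ n \<partial>completion N)) F"
      using assms(5)[of "real n"] by (simp add: discount_power)
  qed (auto simp: discount_nonneg discount_le_1)
  then show "((\<lambda>c. \<integral>\<omega>. f (T c \<omega>) \<partial>completion M) \<longlongrightarrow> (\<integral>\<omega>. f (T' \<omega>) \<partial>completion N)) F"
    by (simp add: inverse_discount_discount)
qed

section \<open>Discounted suprema of paths\<close>

text \<open>A discounted version of $\sup_t w(t)$. When \<open>w\<close> is the indicator of the set of times at which a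
  path is beyond a level, this is $e^{-\beta T}$ for the passage time $T$ over that level. Other choices
  of \<open>w\<close> with values in the unit interval give smoothed versions of $e^{-\beta T}$.\<close>

definition discounted_sup :: "real \<Rightarrow> (real \<Rightarrow> real) \<Rightarrow> real" where
  "discounted_sup \<beta> w = (SUP t\<in>{0..}. exp (- \<beta> * t) * w t)"

lemma discounted_le_1: "0 \<le> \<beta> \<Longrightarrow> 0 \<le> t \<Longrightarrow> 0 \<le> u \<Longrightarrow> u \<le> 1 \<Longrightarrow> exp (- \<beta> * t) * u \<le> (1::real)"
  by (intro mult_le_one) auto

lemma discounted_bdd_above:
  assumes "0 \<le> \<beta>" "\<And>t. 0 \<le> t \<Longrightarrow> 0 \<le> w t \<and> w t \<le> 1" "I \<subseteq> {0..}"
  shows "bdd_above ((\<lambda>t. exp (- \<beta> * t) * w t :: real) ` I)"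
proof (rule bdd_aboveI2)
  fix t assume "t \<in> I"
  then have "0 \<le> t" using assms(3) by auto
  then show "exp (- \<beta> * t) * w t \<le> 1" using assms(1,2) discounted_le_1 by blast
qed

lemma discounted_sup_upper:
  assumes "0 \<le> \<beta>" "\<And>t. 0 \<le> t \<Longrightarrow> 0 \<le> w t \<and> w t \<le> 1" "0 \<le> t"
  shows "exp (- \<beta> * t) * w t \<le> discounted_sup \<beta> w"
  unfolding discounted_sup_def
  using assms by (intro cSUP_upper discounted_bdd_above) auto

lemma discounted_sup_least:
  "(\<And>t. 0 \<le> t \<Longrightarrow> exp (- \<beta> * t) * w t \<le> u) \<Longrightarrow> discounted_sup \<beta> w \<le> u"
  unfolding discounted_sup_def by (rule cSUP_least) auto

lemma discounted_sup_bounds: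
  assumes "0 \<le> \<beta>" "\<And>t. 0 \<le> t \<Longrightarrow> 0 \<le> w t \<and> w t \<le> 1"
  shows "0 \<le> discounted_sup \<beta> w" "discounted_sup \<beta> w \<le> 1"
proof -
  have "0 \<le> exp (- \<beta> * 0) * w 0" using assms(2)[of 0] by simp
  also have "\<dots> \<le> discounted_sup \<beta> w" using assms by (intro discounted_sup_upper) auto
  finally show "0 \<le> discounted_sup \<beta> w" .
  show "discounted_sup \<beta> w \<le> 1" using assms by (intro discounted_sup_least discounted_le_1) auto
qed

lemma discounted_sup_mono:
  assumes "0 \<le> \<beta>" "\<And>t. 0 \<le> t \<Longrightarrow> w t \<le> w' t" "\<And>t. 0 \<le> t \<Longrightarrow> 0 \<le> w' t \<and> w' t \<le> 1"
  shows "discounted_sup \<beta> w \<le> discounted_sup \<beta> w'"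
proof (rule discounted_sup_least)
  fix t :: real assume "0 \<le> t"
  then have "exp (- \<beta> * t) * w t \<le> exp (- \<beta> * t) * w' t" using assms(2) by (intro mult_left_mono) auto
  also have "\<dots> \<le> discounted_sup \<beta> w'" using assms(1,3) \<open>0 \<le> t\<close> by (intro discounted_sup_upper) auto
  finally show "exp (- \<beta> * t) * w t \<le> discounted_sup \<beta> w'" .
qed

lemma discount_first_passage:
  assumes "0 < \<beta>"
  shows "discount \<beta> (first_passage x f) = discounted_sup \<beta> (\<lambda>t. if x \<le> ereal (f t) then 1 else 0)"
    (is "_ = discounted_sup \<beta> ?w")
proof (rule antisym)
  have bounds: "0 \<le> ?w t \<and> ?w t \<le> 1" for t by simp
  show "discounted_sup \<beta> ?w \<le> discount \<beta> (first_passage x f)"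
  proof (rule discounted_sup_least)
    fix t :: real assume t: "0 \<le> t"
    show "exp (- \<beta> * t) * ?w t \<le> discount \<beta> (first_passage x f)"
    proof (cases "x \<le> ereal (f t)")
      case True
      then have "first_passage x f \<le> ennreal t"
        using t unfolding first_passage_def by (intro Inf_lower) auto
      then have "discount \<beta> (ennreal t) \<le> discount \<beta> (first_passage x f)"
        using assms by (intro discount_antimono) auto
      then show ?thesis using True t by simp
    qed (simp add: discount_nonneg)
  qed
  show "discount \<beta> (first_passage x f) \<le> discounted_sup \<beta> ?w"
  proof (cases "first_passage x f")
    case (real \<tau>)
    have "exp (- \<beta> * (\<tau> + e)) \<le> discounted_sup \<beta> ?w" if "e > 0" for e
    proof -
      have "first_passage x f < ennreal (\<tau> + e)" using real that by (simp add: ennreal_less_iff)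
      then obtain s where s: "0 \<le> s" "ennreal s < ennreal (\<tau> + e)" "x \<le> ereal (f s)"
        by (auto simp: first_passage_less_iff)
      then have "s < \<tau> + e" by (simp add: ennreal_less_iff)
      then have "exp (- \<beta> * (\<tau> + e)) \<le> exp (- \<beta> * s) * ?w s" using assms s(3) by simp
      also have "\<dots> \<le> discounted_sup \<beta> ?w"
        using assms bounds s(1) by (intro discounted_sup_upper) auto
      finally show ?thesis .
    qed
    then have ev: "\<forall>\<^sub>F e in at_right 0. exp (- \<beta> * (\<tau> + e)) \<le> discounted_sup \<beta> ?w"
      by (auto simp: eventually_at_filter)
    have "((\<lambda>e. exp (- \<beta> * (\<tau> + e))) \<longlongrightarrow> exp (- \<beta> * (\<tau> + 0))) (at_right 0)"
      by (intro tendsto_intros)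
    from tendsto_upperbound[OF this ev] show ?thesis using real by simp
  qed (use assms bounds discounted_sup_bounds(1)[of \<beta> ?w] in simp)
qed

lemma discounted_sup_time_scale:
  assumes "0 < k"
  shows "discounted_sup \<beta> (\<lambda>t. w (k * t)) = discounted_sup (\<beta> / k) w"
proof -
  have "(*) k ` {0..} = {0..}"
  proof (intro equalityI subsetI)
    fix t :: real assume "t \<in> {0..}"
    then show "t \<in> (*) k ` {0..}" using assms by (intro image_eqI[of _ _ "t / k"]) auto
  qed (use assms in auto)
  then have "discounted_sup (\<beta> / k) w = (SUP t\<in>(*) k ` {0..}. exp (- (\<beta> / k) * t) * w t)"
    by (simp only: discounted_sup_def)
  also have "\<dots> = discounted_sup \<beta> (\<lambda>t. w (k * t))"
    using assms by (simp add: discounted_sup_def image_image)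
  finally show ?thesis by simp
qed

text \<open>With $v = \beta t / k$ the two discount factors differ by
  $e^{-v} - e^{-kv} = e^{-v} (1 - e^{-(k-1)v}) \le (k-1) v e^{-v} \le k - 1$, uniformly in $t$.\<close>

lemma discounted_sup_slower_discount:
  assumes "0 < \<beta>" "1 \<le> k" and w: "\<And>t. 0 \<le> t \<Longrightarrow> 0 \<le> w t \<and> w t \<le> 1"
  shows "discounted_sup (\<beta> / k) w \<le> discounted_sup \<beta> w + (k - 1)"
proof (rule discounted_sup_least)
  fix t :: real assume t: "0 \<le> t"
  define v where "v = \<beta> * t / k"
  have v: "0 \<le> v" "\<beta> * t = k * v" using assms t by (auto simp: v_def)
  have "1 - exp (- ((k - 1) * v)) \<le> (k - 1) * v"
    using exp_ge_add_one_self[of "- ((k - 1) * v)"] by linarith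
  then have "exp (- v) * (1 - exp (- ((k - 1) * v))) \<le> exp (- v) * ((k - 1) * v)"
    by (intro mult_left_mono) auto
  also have "\<dots> \<le> k - 1"
  proof -
    have "v \<le> exp v" using exp_ge_add_one_self[of v] by linarith
    then have "exp (- v) * v \<le> 1" by (simp add: exp_minus field_simps)
    then have "(k - 1) * (exp (- v) * v) \<le> (k - 1) * 1" using assms(2) by (intro mult_left_mono) auto
    then show ?thesis by (simp add: ac_simps)
  qed
  also have "exp (- v) * (1 - exp (- ((k - 1) * v))) = exp (- v) - exp (- (k * v))"
    by (simp add: algebra_simps exp_add[symmetric])
  finally have "exp (- v) \<le> exp (- \<beta> * t) + (k - 1)" using v(2) by simp
  then have "exp (- v) * w t \<le> (exp (- \<beta> * t) + (k - 1)) * w t"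
    using w[OF t] by (intro mult_right_mono) auto
  also have "\<dots> \<le> exp (- \<beta> * t) * w t + (k - 1)"
    using w[OF t] assms(2) mult_left_mono[of "w t" 1 "k - 1"] by (simp add: algebra_simps)
  also have "exp (- \<beta> * t) * w t \<le> discounted_sup \<beta> w"
    using assms t by (intro discounted_sup_upper) auto
  finally show "exp (- (\<beta> / k) * t) * w t \<le> discounted_sup \<beta> w + (k - 1)"
    by (simp add: v_def)
qed

text \<open>Once the indicator is replaced by a continuous function of the path, the supremum is over a
  right-continuous function of time and can be taken over rational times. So the smoothed
  functionals are measurable without completion.\<close>

lemma discounted_sup_rational:
  assumes "0 \<le> \<beta>" and w: "\<And>t. 0 \<le> t \<Longrightarrow> 0 \<le> w t \<and> w t \<le> 1"
    and rc: "\<And>t. 0 \<le> t \<Longrightarrow> (w \<longlongrightarrow> w t) (at_right t)"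
  shows "discounted_sup \<beta> w = (SUP t\<in>{0..} \<inter> \<rat>. exp (- \<beta> * t) * w t)" (is "_ = ?S")
proof (rule antisym)
  have upper: "exp (- \<beta> * t) * w t \<le> ?S" if "0 \<le> t" "t \<in> \<rat>" for t
    using assms(1,2) that by (intro cSUP_upper discounted_bdd_above) auto
  show "discounted_sup \<beta> w \<le> ?S"
  proof (rule discounted_sup_least, rule ccontr)
    fix t :: real assume t: "0 \<le> t" and "\<not> exp (- \<beta> * t) * w t \<le> ?S"
    moreover have "((\<lambda>t. exp (- \<beta> * t) * w t) \<longlongrightarrow> exp (- \<beta> * t) * w t) (at_right t)"
      by (intro tendsto_intros rc t)
    ultimately have "\<forall>\<^sub>F s in at_right t. ?S < exp (- \<beta> * s) * w s"
      by (intro order_tendstoD(1)) auto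
    then obtain b where b: "b > t" "\<And>s. t < s \<Longrightarrow> s < b \<Longrightarrow> ?S < exp (- \<beta> * s) * w s"
      unfolding eventually_at_right_field by blast
    obtain q where "t < real_of_rat q" "real_of_rat q < b" using of_rat_dense[OF b(1)] by blast
    moreover from this have "0 \<le> real_of_rat q" using t by linarith
    then have "exp (- \<beta> * of_rat q) * w (of_rat q) \<le> ?S" by (rule upper) simp
    ultimately show False using b(2)[of "of_rat q"] by linarith
  qed
  show "?S \<le> discounted_sup \<beta> w"
  proof (rule cSUP_least)
    show "{0..} \<inter> \<rat> \<noteq> ({} :: real set)" by (auto intro: exI[of _ 0])
    fix t :: real assume "t \<in> {0..} \<inter> \<rat>"
    then have "0 \<le> t" by simp
    show "exp (- \<beta> * t) * w t \<le> discounted_sup \<beta> w"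
      by (rule discounted_sup_upper[OF assms(1) _ \<open>0 \<le> t\<close>]) (rule w)
  qed
qed

lemma discounted_sup_measurable:
  assumes "0 \<le> \<beta>" "cadlag_process M Y" "continuous_on UNIV \<phi>" "\<And>v. 0 \<le> \<phi> v \<and> \<phi> v \<le> 1"
  shows "(\<lambda>\<omega>. discounted_sup \<beta> (\<lambda>t. \<phi> (Y t \<omega>))) \<in> borel_measurable M"
proof -
  have "(\<lambda>\<omega>. SUP t\<in>{0..} \<inter> \<rat>. exp (- \<beta> * t) * \<phi> (Y t \<omega>)) \<in> borel_measurable M"
  proof (rule borel_measurable_cSUP)
    show "countable ({0::real..} \<inter> \<rat>)" by (intro countable_Int2 countable_rat)
    fix t :: real assume "t \<in> {0..} \<inter> \<rat>"
    then have [measurable]: "Y t \<in> borel_measurable M" using assms(2) by (auto simp: cadlag_process_def)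
    have [measurable]: "\<phi> \<in> borel_measurable borel" using assms(3) by (rule borel_measurable_continuous_onI)
    show "(\<lambda>\<omega>. exp (- \<beta> * t) * \<phi> (Y t \<omega>)) \<in> borel_measurable M" by measurable
  next
    fix \<omega>
    show "bdd_above ((\<lambda>t. exp (- \<beta> * t) * \<phi> (Y t \<omega>)) ` ({0..} \<inter> \<rat>))"
      using assms(1,4) by (intro discounted_bdd_above) auto
  qed
  moreover have "discounted_sup \<beta> (\<lambda>t. \<phi> (Y t \<omega>)) = (SUP t\<in>{0..} \<inter> \<rat>. exp (- \<beta> * t) * \<phi> (Y t \<omega>))"
    if "\<omega> \<in> space M" for \<omega>
  proof (rule discounted_sup_rational)
    fix t :: real assume "0 \<le> t"
    then have "((\<lambda>t. Y t \<omega>) \<longlongrightarrow> Y t \<omega>) (at_right t)"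
      using assms(2) that by (auto simp: cadlag_process_def cadlag_def)
    then show "((\<lambda>t. \<phi> (Y t \<omega>)) \<longlongrightarrow> \<phi> (Y t \<omega>)) (at_right t)"
      using continuous_on_tendsto_compose[OF assms(3)] by simp
  qed (use assms in auto)
  ultimately show ?thesis by (subst measurable_cong) auto
qed

section \<open>Continuity of discounted suprema in the Skorohod topology\<close>

text \<open>A set is open as soon as it contains a set \<^const>\<open>skorohod_nbhd\<close> around each of its paths, so that
  the continuity of a real functional can be checked path by path in terms of these sets alone.\<close>

lemma continuous_map_skorohodI:
  assumes "\<And>p e. cadlag p \<Longrightarrow> 0 < e \<Longrightarrow> \<exists>T. \<exists>d>0. \<forall>y\<in>skorohod_nbhd p T d. \<bar>F y - F p\<bar> < e"
  shows "continuous_map skorohod_topology euclideanreal F"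
  unfolding continuous_map_def
proof (intro conjI allI impI)
  fix U :: "real set" assume "openin euclideanreal U"
  then have U: "open U" by simp
  show "openin skorohod_topology {y \<in> topspace skorohod_topology. F y \<in> U}"
    unfolding openin_skorohod_topology skorohod_open_def topspace_skorohod_topology
  proof (intro conjI ballI)
    fix p assume "p \<in> {y \<in> Collect cadlag. F y \<in> U}"
    then have p: "cadlag p" "F p \<in> U" by auto
    obtain e where e: "e > 0" "\<And>v. \<bar>v - F p\<bar> < e \<Longrightarrow> v \<in> U"
      using U p(2) unfolding open_dist dist_real_def by blast
    obtain T d where "d > 0" "\<forall>y\<in>skorohod_nbhd p T d. \<bar>F y - F p\<bar> < e"
      using assms[OF p(1) e(1)] by blast
    then show "\<exists>T. \<exists>d>0. skorohod_nbhd p T d \<subseteq> {y \<in> Collect cadlag. F y \<in> U}"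
      using e(2) by (intro exI[of _ T] exI[of _ d]) (auto simp: skorohod_nbhd_def)
  qed auto
qed auto

lemma exp_minus_le_add_dist:
  fixes u v :: real
  assumes "0 \<le> u" "0 \<le> v"
  shows "exp (- u) \<le> exp (- v) + \<bar>u - v\<bar>"
proof (cases "v \<le> u")
  case True
  then have "exp (- u) \<le> exp (- v)" by simp
  then show ?thesis by linarith
next
  case False
  have "exp (- u) * (1 - exp (- (v - u))) \<le> 1 * (v - u)"
  proof (intro mult_mono)
    show "1 - exp (- (v - u)) \<le> v - u" using exp_ge_add_one_self[of "- (v - u)"] by linarith
  qed (use False assms in auto)
  moreover have "exp (- u) * (1 - exp (- (v - u))) = exp (- u) - exp (- v)"
    by (simp add: algebra_simps exp_add[symmetric])
  ultimately show ?thesis using False by simp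
qed

text \<open>Discounting cuts off late times, and the time changes in a neighbourhood alter both the discount
  factor and the values of the path uniformly little. No continuity of the path in time is
  needed, since a time change only relabels the times over which the supremum is taken.\<close>

lemma discounted_sup_skorohod_continuous:
  assumes "0 < \<beta>" "0 \<le> L" and \<phi>: "\<And>v. 0 \<le> \<phi> v \<and> \<phi> v \<le> 1"
    and L: "\<And>u v. \<bar>\<phi> u - \<phi> v\<bar> \<le> L * \<bar>u - v\<bar>"
  shows "continuous_map skorohod_topology euclideanreal (\<lambda>y. discounted_sup \<beta> (\<lambda>t. \<phi> (y t)))"
proof (rule continuous_map_skorohodI)
  fix p :: "real \<Rightarrow> real" and e :: real
  assume "cadlag p" "0 < e"
  define T where "T = 1 + 4 / (e * \<beta>)"
  define d where "d = min 1 (e / (4 * (\<beta> + L)))"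
  have "d > 0" using \<open>0 < e\<close> assms by (auto simp: d_def)
  have "d \<le> e / (4 * (\<beta> + L))" "d \<le> 1" by (auto simp: d_def)
  then have d: "\<beta> * d + L * d \<le> e / 4" "d \<le> 1"
    using assms by (auto simp: field_simps)
  (* The margin d allows for time changes that move a time later than T to one before T. *)
  have tail: "exp (- \<beta> * t) \<le> e / 4" if "t > T - d" for t
  proof -
    have "4 / e = \<beta> * (T - 1)" using assms \<open>0 < e\<close> by (simp add: T_def)
    also have "\<dots> \<le> \<beta> * t" using that d(2) assms by (intro mult_left_mono) auto
    finally have "exp (- \<beta> * t) \<le> exp (- (4 / e))" by simp
    also have "\<dots> \<le> e / 4"
      using exp_ge_add_one_self[of "4 / e"] \<open>0 < e\<close> by (simp add: exp_minus field_simps)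
    finally show ?thesis .
  qed
  have step: "exp (- \<beta> * t) * \<phi> u \<le> exp (- \<beta> * s) * \<phi> v + e / 4"
    if "0 \<le> t" "0 \<le> s" "\<bar>t - s\<bar> < d" "\<bar>u - v\<bar> < d" for s t u v
  proof -
    have "exp (- \<beta> * t) \<le> exp (- \<beta> * s) + \<bar>\<beta> * t - \<beta> * s\<bar>"
      using exp_minus_le_add_dist[of "\<beta> * t" "\<beta> * s"] that assms by simp
    also have "\<bar>\<beta> * t - \<beta> * s\<bar> = \<beta> * \<bar>t - s\<bar>"
      using assms by (simp add: abs_mult right_diff_distrib[symmetric])
    also have "\<dots> \<le> \<beta> * d" using that assms by (intro mult_left_mono) auto
    finally have "exp (- \<beta> * t) * \<phi> u \<le> (exp (- \<beta> * s) + \<beta> * d) * \<phi> u"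
      using \<phi>[of u] by (intro mult_right_mono) auto
    also have "\<dots> \<le> exp (- \<beta> * s) * \<phi> u + \<beta> * d"
      using \<phi>[of u] \<open>d > 0\<close> assms mult_left_mono[of "\<phi> u" 1 "\<beta> * d"] by (simp add: algebra_simps)
    also have "exp (- \<beta> * s) * \<phi> u \<le> exp (- \<beta> * s) * \<phi> v + L * d"
    proof -
      have "\<phi> u - \<phi> v \<le> L * \<bar>u - v\<bar>" using L[of u v] by linarith
      also have "\<dots> \<le> L * d" using that assms by (intro mult_left_mono) auto
      finally have "exp (- \<beta> * s) * (\<phi> u - \<phi> v) \<le> exp (- \<beta> * s) * (L * d)"
        by (intro mult_left_mono) auto
      also have "\<dots> \<le> 1 * (L * d)" using that assms \<open>d > 0\<close> by (intro mult_right_mono) auto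
      finally show ?thesis by (simp add: algebra_simps)
    qed
    finally show ?thesis using d(1) by linarith
  qed
  show "\<exists>T. \<exists>d>0. \<forall>y\<in>skorohod_nbhd p T d.
      \<bar>discounted_sup \<beta> (\<lambda>t. \<phi> (y t)) - discounted_sup \<beta> (\<lambda>t. \<phi> (p t))\<bar> < e"
  proof (intro exI conjI ballI)
    fix y assume "y \<in> skorohod_nbhd p T d"
    then obtain l where l: "bij_betw l {0..} {0..}" "\<And>s. 0 \<le> s \<Longrightarrow> \<bar>l s - s\<bar> < d"
      "\<And>s. 0 \<le> s \<Longrightarrow> s \<le> T \<Longrightarrow> \<bar>y (l s) - p s\<bar> < d"
      by (auto simp: skorohod_nbhd_def time_change_def)
    have upper: "exp (- \<beta> * t) * \<phi> (x t) \<le> discounted_sup \<beta> (\<lambda>t. \<phi> (x t))" if "0 \<le> t" for x t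
      by (rule discounted_sup_upper[of \<beta> "\<lambda>t. \<phi> (x t)"]) (use assms that in auto)
    have nonneg: "0 \<le> discounted_sup \<beta> (\<lambda>t. \<phi> (x t))" for x
      using assms by (intro discounted_sup_bounds) auto
    have late: "exp (- \<beta> * t) * \<phi> v \<le> e / 4" if "t > T - d" for t v
      using mult_mono[OF tail[OF that], of "\<phi> v" 1] \<phi>[of v] \<open>0 < e\<close> by simp
    have "discounted_sup \<beta> (\<lambda>t. \<phi> (p t)) \<le> discounted_sup \<beta> (\<lambda>t. \<phi> (y t)) + e / 4"
    proof (rule discounted_sup_least)
      fix s :: real assume s: "0 \<le> s"
      then have "0 \<le> l s" using l(1) by (auto simp: bij_betw_def)
      show "exp (- \<beta> * s) * \<phi> (p s) \<le> discounted_sup \<beta> (\<lambda>t. \<phi> (y t)) + e / 4"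
      proof (cases "s \<le> T")
        case True
        show ?thesis
          using step[OF s \<open>0 \<le> l s\<close>, of "p s" "y (l s)"] l(2)[OF s] l(3)[OF s True] upper[OF \<open>0 \<le> l s\<close>, of y]
          by (auto simp: abs_minus_commute)
      next
        case False
        then show ?thesis using late[of s "p s"] nonneg[of y] \<open>d > 0\<close> by auto
      qed
    qed
    moreover have "discounted_sup \<beta> (\<lambda>t. \<phi> (y t)) \<le> discounted_sup \<beta> (\<lambda>t. \<phi> (p t)) + e / 4"
    proof (rule discounted_sup_least)
      fix t :: real assume t: "0 \<le> t"
      then obtain s where s: "0 \<le> s" "t = l s" using l(1) by (auto simp: bij_betw_def image_iff)
      show "exp (- \<beta> * t) * \<phi> (y t) \<le> discounted_sup \<beta> (\<lambda>t. \<phi> (p t)) + e / 4"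
      proof (cases "s \<le> T")
        case True
        show ?thesis
          using step[OF t s(1), of "y t" "p s"] l(2)[OF s(1)] l(3)[OF s(1) True] upper[OF s(1), of p] s(2)
          by auto
      next
        case False
        then have "t > T - d" using l(2)[OF s(1)] s(2) by linarith
        then show ?thesis using late[of t "y t"] nonneg[of p] by auto
      qed
    qed
    ultimately show "\<bar>discounted_sup \<beta> (\<lambda>t. \<phi> (y t)) - discounted_sup \<beta> (\<lambda>t. \<phi> (p t))\<bar> < e"
      using \<open>0 < e\<close> by linarith
  qed (fact \<open>d > 0\<close>)
qed

section \<open>Cadlag processes under continuous maps and scaling of time\<close>

lemma cadlag_continuous_image:
  assumes "cadlag f" "continuous_on UNIV g"
  shows "cadlag (\<lambda>t. g (f t))"
  unfolding cadlag_def
proof (intro conjI allI impI)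
  fix t :: real assume "0 \<le> t"
  then show "((\<lambda>t. g (f t)) \<longlongrightarrow> g (f t)) (at_right t)"
    using assms(1) continuous_on_tendsto_compose[OF assms(2)] by (auto simp: cadlag_def)
next
  fix t :: real assume "0 < t"
  then obtain l where "(f \<longlongrightarrow> l) (at_left t)" using assms(1) by (auto simp: cadlag_def)
  then show "\<exists>l. ((\<lambda>t. g (f t)) \<longlongrightarrow> l) (at_left t)"
    using continuous_on_tendsto_compose[OF assms(2)] by auto
qed

lemma cadlag_time_scale:
  assumes "cadlag f" "0 < c"
  shows "cadlag (\<lambda>t. f (c * t))"
  unfolding cadlag_def
proof (intro conjI allI impI)
  fix t :: real assume "0 \<le> t"
  then have "(f \<longlongrightarrow> f (c * t)) (at_right (c * t))" using assms by (auto simp: cadlag_def)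
  moreover have "filterlim ((*) c) (at_right (c * t)) (at_right t)"
    using assms(2) by (simp add: filterlim_def filtermap_times_pos_at_right)
  ultimately show "((\<lambda>t. f (c * t)) \<longlongrightarrow> f (c * t)) (at_right t)" by (rule filterlim_compose)
next
  fix t :: real assume "0 < t"
  then have "0 < c * t" using assms(2) by simp
  then obtain l where "(f \<longlongrightarrow> l) (at_left (c * t))"
    using assms(1) unfolding cadlag_def by blast
  moreover have "filterlim ((*) c) (at_left (c * t)) (at_left t)"
    unfolding filterlim_at
    using assms(2) by (auto intro!: tendsto_intros simp: eventually_at_filter)
  ultimately show "\<exists>l. ((\<lambda>t. f (c * t)) \<longlongrightarrow> l) (at_left t)" using filterlim_compose by blast
qed

lemma cadlag_process_continuous_image:
  assumes "cadlag_process M X" "continuous_on UNIV g"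
  shows "cadlag_process M (\<lambda>t \<omega>. g (X t \<omega>))"
proof -
  have [measurable]: "g \<in> borel_measurable borel" using assms(2) by (rule borel_measurable_continuous_onI)
  show ?thesis
    unfolding cadlag_process_def
  proof (intro conjI allI impI ballI)
    fix t :: real assume "0 \<le> t"
    then have [measurable]: "X t \<in> borel_measurable M" using assms(1) by (simp add: cadlag_process_def)
    show "(\<lambda>\<omega>. g (X t \<omega>)) \<in> borel_measurable M" by measurable
  next
    fix \<omega> assume "\<omega> \<in> space M"
    then have "cadlag (\<lambda>t. X t \<omega>)" using assms(1) by (simp add: cadlag_process_def)
    then show "cadlag (\<lambda>t. g (X t \<omega>))" using assms(2) by (rule cadlag_continuous_image)
  qed
qed

lemma cadlag_process_time_scale:
  assumes "cadlag_process M X" "0 < c"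
  shows "cadlag_process M (\<lambda>t. X (c * t))"
  unfolding cadlag_process_def
proof (intro conjI allI impI ballI)
  fix t :: real assume "0 \<le> t"
  then show "X (c * t) \<in> borel_measurable M" using assms by (simp add: cadlag_process_def)
next
  fix \<omega> assume "\<omega> \<in> space M"
  then have "cadlag (\<lambda>t. X t \<omega>)" using assms(1) by (simp add: cadlag_process_def)
  then show "cadlag (\<lambda>t. X (c * t) \<omega>)" using assms(2) by (rule cadlag_time_scale)
qed

section \<open>First passage times of a rescaled process\<close>

definition ramp :: "real \<Rightarrow> real \<Rightarrow> real \<Rightarrow> real" where
  "ramp r s v = min 1 (max 0 ((v - r) / (s - r)))"

lemma ramp_bounds: "0 \<le> ramp r s v \<and> ramp r s v \<le> 1"
  by (simp add: ramp_def)

lemma ramp_le_indicator: "r < s \<Longrightarrow> ramp r s v \<le> (if r \<le> v then 1 else 0)"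
  by (auto simp: ramp_def divide_le_0_iff)

lemma indicator_le_ramp: "r < s \<Longrightarrow> (if s \<le> v then 1 else 0) \<le> ramp r s v"
  by (auto simp: ramp_def)

lemma ramp_scale: "0 < k \<Longrightarrow> ramp (k * r) (k * s) (k * v) = ramp r s v"
  by (simp add: ramp_def right_diff_distrib[symmetric])

lemma ramp_lipschitz:
  assumes "r < s"
  shows "\<bar>ramp r s u - ramp r s v\<bar> \<le> 1 / (s - r) * \<bar>u - v\<bar>"
proof -
  have "\<bar>min 1 (max 0 x) - min 1 (max 0 y)\<bar> \<le> \<bar>x - y\<bar>" for x y :: real by linarith
  then have "\<bar>ramp r s u - ramp r s v\<bar> \<le> \<bar>(u - r) / (s - r) - (v - r) / (s - r)\<bar>"
    unfolding ramp_def .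
  also have "\<dots> = 1 / (s - r) * \<bar>u - v\<bar>"
    using assms by (simp add: diff_divide_distrib[symmetric])
  finally show ?thesis .
qed

text \<open>Write \<open>T(y)\<close> for the first time at which $g \circ y$ reaches $1$, and \<open>R \<beta> r s y\<close> for the smoothed
  version of $e^{-\beta T(y)}$ in which a ramp from \<open>r\<close> to \<open>s\<close> replaces the indicator of $[1,\infty)$. Then
  \<open>R \<beta> 1 \<rho> \<le> exp (- \<beta> T) \<le> R \<beta> (1/\<rho>) 1\<close> for every $\rho > 1$. The outer functionals are continuous, so
  that their expectations under the law of $Y_c$ tend to the limits \<open>G \<beta> 1 \<rho>\<close> and \<open>G \<beta> (1/\<rho>) 1\<close>, between
  which the expectation of $e^{-\beta T(\zeta)}$ lies as well.

  It remains to see that these two limits are close when $\rho$ is near $1$, which expresses that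
  $T(\zeta)$ is unlikely to change much when the level $1$ is varied slightly. The reason is
  self-similarity: since $Y_{kc}(t) = k^{-1/\alpha} Y_c(kt)$, multiplying the levels by $k^{1/\alpha}$ has in the
  limit the same effect as multiplying $\beta$ by $k$, and a change of $\beta$ is harmless by
  \<open>discounted_sup_slower_discount\<close>.\<close>

theorem first_passage_converges_in_law:
  fixes M :: "'m measure" and N :: "'n measure" and g :: "real \<Rightarrow> real"
    and X :: "real \<Rightarrow> 'm \<Rightarrow> real" and \<zeta> :: "real \<Rightarrow> 'n \<Rightarrow> real"
  assumes "0 < \<alpha>" and M: "prob_space M" and N: "prob_space N"
    and X: "cadlag_process M X" and \<zeta>: "cadlag_process N \<zeta>"
    and conv: "converges_in_law skorohod_topology (at_right 0)
           M (\<lambda>c \<omega> t. c powr (- 1 / \<alpha>) * X (c * t) \<omega>) N (\<lambda>\<omega> t. \<zeta> t \<omega>)"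
    and "0 \<le> K" and lip: "\<And>u v. \<bar>g u - g v\<bar> \<le> K * \<bar>u - v\<bar>"
    and hom: "\<And>k v. 0 < k \<Longrightarrow> g (k * v) = k * g v"
  shows "converges_in_law euclidean (at_right 0)
           M (\<lambda>c \<omega>. first_passage 1 (\<lambda>t. g (c powr (- 1 / \<alpha>) * X (c * t) \<omega>)))
           N (\<lambda>\<omega>. first_passage 1 (\<lambda>t. g (\<zeta> t \<omega>)))"
proof -
  interpret cN: prob_space "completion N" using N by (rule prob_space.prob_space_completion)
  define Y where "Y c t \<omega> = c powr (- 1 / \<alpha>) * X (c * t) \<omega>" for c t \<omega>
  define R where "R \<beta> r s y = discounted_sup \<beta> (\<lambda>t. ramp r s (g (y t)))" for \<beta> r s and y :: "real \<Rightarrow> real"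
  define G where "G \<beta> r s = (\<integral>\<omega>. R \<beta> r s (\<lambda>t. \<zeta> t \<omega>) \<partial>completion N)" for \<beta> r s
  define D where "D \<beta> y = discount \<beta> (first_passage 1 (\<lambda>t. g (y t)))" for \<beta> and y :: "real \<Rightarrow> real"
  have cont_g: "continuous_on UNIV g"
    using lip \<open>0 \<le> K\<close> by (intro lipschitz_on_continuous_on[of K] lipschitz_onI) (auto simp: dist_real_def)
  have cont_ramp: "continuous_on UNIV (\<lambda>v. ramp r s (g v))" if "r < s" for r s
    unfolding ramp_def using that by (intro continuous_intros cont_g) auto
  have Y: "cadlag_process M (Y c)" if "0 < c" for c
    using cadlag_process_continuous_image[OF cadlag_process_time_scale[OF X that], of "\<lambda>v. c powr (- 1 / \<alpha>) * v"]
    by (simp add: Y_def[abs_def] continuous_intros)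
  have ev_pos: "\<forall>\<^sub>F c::real in at_right 0. 0 < c" by (simp add: eventually_at_filter)

  have R_bounds: "0 \<le> R \<beta> r s y" "R \<beta> r s y \<le> 1" if "0 < \<beta>" for \<beta> r s y
    unfolding R_def using that ramp_bounds by (auto intro!: discounted_sup_bounds)
  have R_int: "integrable (completion P) (\<lambda>\<omega>. R \<beta> r s (\<lambda>t. V t \<omega>))"
    if "prob_space P" "cadlag_process P V" "0 < \<beta>" "r < s" for \<beta> r s and P :: "'z measure" and V
  proof -
    interpret cP: prob_space "completion P" using that(1) by (rule prob_space.prob_space_completion)
    have "(\<lambda>\<omega>. R \<beta> r s (\<lambda>t. V t \<omega>)) \<in> borel_measurable P"
      unfolding R_def using that ramp_bounds cont_ramp by (intro discounted_sup_measurable) auto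
    then have "(\<lambda>\<omega>. R \<beta> r s (\<lambda>t. V t \<omega>)) \<in> borel_measurable (completion P)"
      by (rule measurable_completion)
    then show ?thesis
      using R_bounds[OF that(3)] by (intro cP.integrable_const_bound[where B = 1]) auto
  qed
  have T_meas: "(\<lambda>\<omega>. first_passage 1 (\<lambda>t. g (V t \<omega>))) \<in> borel_measurable (completion P)"
    if "prob_space P" "cadlag_process P V" for P :: "'z measure" and V
    using first_passage_measurable[OF prob_space.finite_measure[OF that(1)]
        cadlag_process_continuous_image[OF that(2) cont_g], of 1]
    by (simp add: one_ereal_def)
  have D_int: "integrable (completion P) (\<lambda>\<omega>. D \<beta> (\<lambda>t. V t \<omega>))"
    if "prob_space P" "cadlag_process P V" "0 < \<beta>" for \<beta> and P :: "'z measure" and V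
  proof -
    interpret cP: prob_space "completion P" using that(1) by (rule prob_space.prob_space_completion)
    have "(\<lambda>\<omega>. D \<beta> (\<lambda>t. V t \<omega>)) \<in> borel_measurable (completion P)"
      unfolding D_def using T_meas[OF that(1,2)] by measurable
    then show ?thesis
      using that(3) by (intro cP.integrable_const_bound[where B = 1]) (auto simp: D_def discount_nonneg discount_le_1)
  qed
  have D_eq: "D \<beta> y = discounted_sup \<beta> (\<lambda>t. if 1 \<le> g (y t) then 1 else 0)" if "0 < \<beta>" for \<beta> y
    unfolding D_def using discount_first_passage[OF that, of 1] by (simp add: one_ereal_def)
  have D_le_R: "D \<beta> y \<le> R \<beta> r 1 y" if "0 < \<beta>" "r < 1" for \<beta> r y
    unfolding D_eq[OF that(1)] R_def
    using that ramp_bounds indicator_le_ramp[OF that(2)] by (intro discounted_sup_mono) auto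
  have R_le_D: "R \<beta> 1 s y \<le> D \<beta> y" if "0 < \<beta>" "1 < s" for \<beta> s y
    unfolding D_eq[OF that(1)] R_def
    using that ramp_le_indicator[OF that(2)] by (intro discounted_sup_mono) auto

  have R_lim: "((\<lambda>c. \<integral>\<omega>. R \<beta> r s (\<lambda>t. Y c t \<omega>) \<partial>completion M) \<longlongrightarrow> G \<beta> r s) (at_right 0)"
    if "0 < \<beta>" "r < s" for \<beta> r s
  proof -
    have "continuous_map skorohod_topology euclideanreal (R \<beta> r s)"
      unfolding R_def
    proof (rule discounted_sup_skorohod_continuous[OF that(1), of "1 / (s - r) * K"])
      fix u v
      have "\<bar>ramp r s (g u) - ramp r s (g v)\<bar> \<le> 1 / (s - r) * \<bar>g u - g v\<bar>" by (rule ramp_lipschitz[OF that(2)])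
      also have "\<dots> \<le> 1 / (s - r) * (K * \<bar>u - v\<bar>)"
        using that(2) by (intro mult_left_mono lip) auto
      finally show "\<bar>ramp r s (g u) - ramp r s (g v)\<bar> \<le> 1 / (s - r) * K * \<bar>u - v\<bar>" by simp
    qed (use that \<open>0 \<le> K\<close> ramp_bounds in auto)
    moreover have "bounded (R \<beta> r s ` topspace skorohod_topology)"
      using R_bounds[OF that(1)] by (intro boundedI[where B = 1]) auto
    ultimately show ?thesis
      using conv unfolding converges_in_law_def G_def Y_def by blast
  qed

  \<comment> \<open>The families $c \mapsto Y_c$ and $c \mapsto Y_{kc}$ have the same limit as $c$ tends to $0$.\<close>
  have G_scale: "G \<beta> r s = G (\<beta> / k) (k powr (1 / \<alpha>) * r) (k powr (1 / \<alpha>) * s)"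
    if "0 < \<beta>" "r < s" "0 < k" for \<beta> r s k
  proof -
    let ?\<kappa> = "k powr (1 / \<alpha>)"
    have "0 < ?\<kappa>" using that(3) by simp
    have "R \<beta> r s (\<lambda>t. Y (k * c) t \<omega>) = R (\<beta> / k) (?\<kappa> * r) (?\<kappa> * s) (\<lambda>t. Y c t \<omega>)" if "0 < c" for c \<omega>
    proof -
      have "?\<kappa> * Y (k * c) t \<omega> = Y c (k * t) \<omega>" for t
        using \<open>0 < k\<close> that by (simp add: Y_def powr_mult powr_minus field_simps)
      then have "?\<kappa> * g (Y (k * c) t \<omega>) = g (Y c (k * t) \<omega>)" for t
        using hom[OF \<open>0 < ?\<kappa>\<close>] by metis
      then have "ramp r s (g (Y (k * c) t \<omega>)) = ramp (?\<kappa> * r) (?\<kappa> * s) (g (Y c (k * t) \<omega>))" for t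
        using ramp_scale[OF \<open>0 < ?\<kappa>\<close>] by metis
      then show ?thesis
        unfolding R_def
        using discounted_sup_time_scale[OF \<open>0 < k\<close>, of \<beta> "\<lambda>t. ramp (?\<kappa> * r) (?\<kappa> * s) (g (Y c t \<omega>))"] by simp
    qed
    then have "\<forall>\<^sub>F c in at_right 0. (\<integral>\<omega>. R (\<beta> / k) (?\<kappa> * r) (?\<kappa> * s) (\<lambda>t. Y c t \<omega>) \<partial>completion M) =
        (\<integral>\<omega>. R \<beta> r s (\<lambda>t. Y (k * c) t \<omega>) \<partial>completion M)"
      using ev_pos by (auto elim: eventually_mono)
    moreover have "((\<lambda>c. \<integral>\<omega>. R (\<beta> / k) (?\<kappa> * r) (?\<kappa> * s) (\<lambda>t. Y c t \<omega>) \<partial>completion M)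
        \<longlongrightarrow> G (\<beta> / k) (?\<kappa> * r) (?\<kappa> * s)) (at_right 0)"
      using that \<open>0 < ?\<kappa>\<close> by (intro R_lim) auto
    ultimately have "((\<lambda>c. \<integral>\<omega>. R \<beta> r s (\<lambda>t. Y (k * c) t \<omega>) \<partial>completion M)
        \<longlongrightarrow> G (\<beta> / k) (?\<kappa> * r) (?\<kappa> * s)) (at_right 0)"
      by (rule Lim_transform_eventually[rotated])
    moreover have "filterlim ((*) k) (at_right 0) (at_right 0)"
      using filtermap_times_pos_at_right[OF that(3), of 0] by (simp add: filterlim_def)
    then have "((\<lambda>c. \<integral>\<omega>. R \<beta> r s (\<lambda>t. Y (k * c) t \<omega>) \<partial>completion M) \<longlongrightarrow> G \<beta> r s) (at_right 0)"
      by (rule filterlim_compose[OF R_lim[OF that(1,2)]])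
    ultimately show ?thesis
      by (intro tendsto_unique[OF trivial_limit_at_right_real])
  qed

  \<comment> \<open>The value of $\rho$ is such that $k = 1 + \delta$ multiplies the levels by $\rho^2$, which lifts the ramp
    from $1/\rho$ to $1$ above the ramp from $1$ to $\rho$.\<close>
  have G_close: "G \<beta> (1 / \<rho>) 1 \<le> G \<beta> 1 \<rho> + \<delta>"
    if "0 < \<beta>" "0 < \<delta>" and \<rho>: "\<rho> = (1 + \<delta>) powr (1 / \<alpha> / 2)" for \<beta> \<delta> \<rho>
  proof -
    define k where "k = 1 + \<delta>"
    have k: "1 < k" "k powr (1 / \<alpha>) = \<rho> * \<rho>"
      using that by (simp_all add: k_def powr_add[symmetric])
    have "1 < \<rho>" using that \<open>0 < \<alpha>\<close> by (simp add: \<rho> gr_one_powr)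
    have "G \<beta> (1 / \<rho>) 1 = G (\<beta> / k) (k powr (1 / \<alpha>) * (1 / \<rho>)) (k powr (1 / \<alpha>) * 1)"
      using that k \<open>1 < \<rho>\<close> by (intro G_scale) auto
    also have "\<dots> = G (\<beta> / k) \<rho> (\<rho> * \<rho>)" using \<open>1 < \<rho>\<close> by (simp add: k)
    also have "\<dots> \<le> (\<integral>\<omega>. R \<beta> 1 \<rho> (\<lambda>t. \<zeta> t \<omega>) + \<delta> \<partial>completion N)"
      unfolding G_def
    proof (rule integral_mono)
      fix \<omega>
      have "R (\<beta> / k) \<rho> (\<rho> * \<rho>) (\<lambda>t. \<zeta> t \<omega>) \<le> R (\<beta> / k) 1 \<rho> (\<lambda>t. \<zeta> t \<omega>)"
        unfolding R_def
      proof (rule discounted_sup_mono)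
        fix t
        show "ramp \<rho> (\<rho> * \<rho>) (g (\<zeta> t \<omega>)) \<le> ramp 1 \<rho> (g (\<zeta> t \<omega>))"
          using ramp_le_indicator[of \<rho> "\<rho> * \<rho>" "g (\<zeta> t \<omega>)"] indicator_le_ramp[of 1 \<rho> "g (\<zeta> t \<omega>)"] \<open>1 < \<rho>\<close>
          by simp
      qed (use that k ramp_bounds in auto)
      also have "\<dots> \<le> R \<beta> 1 \<rho> (\<lambda>t. \<zeta> t \<omega>) + (k - 1)"
        unfolding R_def using that k ramp_bounds by (intro discounted_sup_slower_discount) auto
      finally show "R (\<beta> / k) \<rho> (\<rho> * \<rho>) (\<lambda>t. \<zeta> t \<omega>) \<le> R \<beta> 1 \<rho> (\<lambda>t. \<zeta> t \<omega>) + \<delta>" by (simp add: k_def)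
    qed (use R_int[OF N \<zeta>] that k \<open>1 < \<rho>\<close> in auto)
    also have "\<dots> = G \<beta> 1 \<rho> + \<delta>"
      using R_int[OF N \<zeta>] that \<open>1 < \<rho>\<close> by (simp add: G_def prob_space.prob_space[OF N])
    finally show ?thesis .
  qed

  have "((\<lambda>c. \<integral>\<omega>. D \<beta> (\<lambda>t. Y c t \<omega>) \<partial>completion M) \<longlongrightarrow> (\<integral>\<omega>. D \<beta> (\<lambda>t. \<zeta> t \<omega>) \<partial>completion N)) (at_right 0)"
    if "0 < \<beta>" for \<beta>
  proof (rule tendstoI)
    fix e :: real assume "0 < e"
    define \<delta> where "\<delta> = e / 4"
    define \<rho> where "\<rho> = (1 + \<delta>) powr (1 / \<alpha> / 2)"
    have "0 < \<delta>" using \<open>0 < e\<close> by (simp add: \<delta>_def)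
    have "1 < \<rho>" using \<open>0 < \<delta>\<close> \<open>0 < \<alpha>\<close> by (simp add: \<rho>_def gr_one_powr)
    then have "1 / \<rho> < 1" by simp
    note close = G_close[OF that \<open>0 < \<delta>\<close> \<rho>_def]
    have \<zeta>_le: "(\<integral>\<omega>. D \<beta> (\<lambda>t. \<zeta> t \<omega>) \<partial>completion N) \<le> G \<beta> (1 / \<rho>) 1"
      unfolding G_def
      using R_int[OF N \<zeta> that \<open>1 / \<rho> < 1\<close>] D_int[OF N \<zeta> that] D_le_R[OF that \<open>1 / \<rho> < 1\<close>]
      by (intro integral_mono) auto
    have \<zeta>_ge: "G \<beta> 1 \<rho> \<le> (\<integral>\<omega>. D \<beta> (\<lambda>t. \<zeta> t \<omega>) \<partial>completion N)"
      unfolding G_def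
      using R_int[OF N \<zeta> that \<open>1 < \<rho>\<close>] D_int[OF N \<zeta> that] R_le_D[OF that \<open>1 < \<rho>\<close>]
      by (intro integral_mono) auto
    have "\<forall>\<^sub>F c in at_right 0. (\<integral>\<omega>. R \<beta> (1 / \<rho>) 1 (\<lambda>t. Y c t \<omega>) \<partial>completion M) < G \<beta> (1 / \<rho>) 1 + \<delta>"
      using R_lim[OF that \<open>1 / \<rho> < 1\<close>] \<open>0 < \<delta>\<close> by (intro order_tendstoD(2)) auto
    moreover have "\<forall>\<^sub>F c in at_right 0. G \<beta> 1 \<rho> - \<delta> < (\<integral>\<omega>. R \<beta> 1 \<rho> (\<lambda>t. Y c t \<omega>) \<partial>completion M)"
      using R_lim[OF that \<open>1 < \<rho>\<close>] \<open>0 < \<delta>\<close> by (intro order_tendstoD(1)) auto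
    ultimately show "\<forall>\<^sub>F c in at_right 0.
        dist (\<integral>\<omega>. D \<beta> (\<lambda>t. Y c t \<omega>) \<partial>completion M) (\<integral>\<omega>. D \<beta> (\<lambda>t. \<zeta> t \<omega>) \<partial>completion N) < e"
      using ev_pos
    proof eventually_elim
      case (elim c)
      have "(\<integral>\<omega>. D \<beta> (\<lambda>t. Y c t \<omega>) \<partial>completion M) \<le> (\<integral>\<omega>. R \<beta> (1 / \<rho>) 1 (\<lambda>t. Y c t \<omega>) \<partial>completion M)"
        using R_int[OF M Y[OF elim(3)] that \<open>1 / \<rho> < 1\<close>] D_int[OF M Y[OF elim(3)] that] D_le_R[OF that \<open>1 / \<rho> < 1\<close>]
        by (intro integral_mono) auto
      moreover have "(\<integral>\<omega>. R \<beta> 1 \<rho> (\<lambda>t. Y c t \<omega>) \<partial>completion M) \<le> (\<integral>\<omega>. D \<beta> (\<lambda>t. Y c t \<omega>) \<partial>completion M)"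
        using R_int[OF M Y[OF elim(3)] that \<open>1 < \<rho>\<close>] D_int[OF M Y[OF elim(3)] that] R_le_D[OF that \<open>1 < \<rho>\<close>]
        by (intro integral_mono) auto
      ultimately have "\<bar>(\<integral>\<omega>. D \<beta> (\<lambda>t. Y c t \<omega>) \<partial>completion M) - (\<integral>\<omega>. D \<beta> (\<lambda>t. \<zeta> t \<omega>) \<partial>completion N)\<bar> \<le> 2 * \<delta>"
        using elim(1,2) \<zeta>_le \<zeta>_ge close unfolding abs_le_iff by linarith
      then show ?case using \<open>0 < e\<close> by (simp add: dist_real_def \<delta>_def)
    qed
  qed
  then have "converges_in_law euclidean (at_right 0)
           M (\<lambda>c \<omega>. first_passage 1 (\<lambda>t. g (Y c t \<omega>)))
           N (\<lambda>\<omega>. first_passage 1 (\<lambda>t. g (\<zeta> t \<omega>)))"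
    using T_meas[OF M Y] T_meas[OF N \<zeta>] ev_pos unfolding D_def
    by (intro converges_in_law_ennreal_if_discounts_converge M N) (auto elim: eventually_mono)
  then show ?thesis by (simp only: Y_def)
qed

section \<open>Exit times from intervals\<close>

lemma converges_in_law_cong:
  fixes X X' :: "'c \<Rightarrow> 'm \<Rightarrow> 'x"
  assumes "\<forall>\<^sub>F c in F. \<forall>\<omega>. X c \<omega> = X' c \<omega>"
  shows "converges_in_law S F M X N Y \<longleftrightarrow> converges_in_law S F M X' N Y"
proof -
  have "((\<lambda>c. \<integral>\<omega>. f (X c \<omega>) \<partial>completion M) \<longlongrightarrow> l) F \<longleftrightarrow>
      ((\<lambda>c. \<integral>\<omega>. f (X' c \<omega>) \<partial>completion M) \<longlongrightarrow> l) F" for f :: "'x \<Rightarrow> real" and l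
    by (rule tendsto_cong) (use assms in \<open>auto elim: eventually_mono\<close>)
  then show ?thesis unfolding converges_in_law_def by simp
qed

text \<open>The interval $(-b,a)$ is the set where its gauge $\max (v/a, -v/b)$ is less than $1$; an infinite
  endpoint contributes the coefficient $0$.\<close>

lemma exit_time_eq_first_passage_gauge:
  fixes a b :: ereal
  assumes "0 < a" "0 < b"
  obtains A B :: real where "0 \<le> A" "0 \<le> B"
    "\<And>f. exit_time b a f = first_passage 1 (\<lambda>t. max (A * f t) (- (B * f t)))"
proof -
  define A where "A = real_of_ereal (1 / a)"
  define B where "B = real_of_ereal (1 / b)"
  have A: "0 \<le> A" "a \<le> ereal v \<longleftrightarrow> 1 \<le> A * v" for v
    using assms(1) by (cases a; auto simp: A_def field_simps one_ereal_def)+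
  have B: "0 \<le> B" "ereal v \<le> - b \<longleftrightarrow> 1 \<le> - (B * v)" for v
    using assms(2) by (cases b; auto simp: B_def field_simps one_ereal_def)+
  have "ereal v \<notin> {- b<..<a} \<longleftrightarrow> 1 \<le> ereal (max (A * v) (- (B * v)))" for v
  proof -
    have "ereal v \<notin> {- b<..<a} \<longleftrightarrow> a \<le> ereal v \<or> ereal v \<le> - b" by auto
    also have "\<dots> \<longleftrightarrow> 1 \<le> max (A * v) (- (B * v))" using A(2) B(2) by (auto simp: le_max_iff_disj)
    also have "\<dots> \<longleftrightarrow> 1 \<le> ereal (max (A * v) (- (B * v)))" by (simp only: one_ereal_def ereal_less_eq)
    finally show ?thesis .
  qed
  then show ?thesis using A(1) B(1) by (intro that[of A B]) (simp_all add: exit_time_def first_passage_def)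
qed

text \<open>Speeding up time by \<open>c\<close> divides hitting times by \<open>c\<close>, and dividing the path by \<open>\<kappa>\<close> has the same
  effect as multiplying the levels by \<open>\<kappa>\<close>.\<close>

lemma exit_time_scale:
  assumes "0 < c" "0 < \<kappa>"
  shows "exit_time (b * ereal \<kappa>) (a * ereal \<kappa>) f / ennreal c = exit_time b a (\<lambda>t. f (c * t) / \<kappa>)"
proof -
  have levels: "ereal v \<notin> {- (b * ereal \<kappa>)<..<a * ereal \<kappa>} \<longleftrightarrow> ereal (v / \<kappa>) \<notin> {- b<..<a}" for v
    using assms(2) by (cases a; cases b) (auto simp: field_simps)
  have times: "{ennreal t |t. 0 \<le> t \<and> P t} = (\<lambda>u. u * ennreal c) ` {ennreal t |t. 0 \<le> t \<and> P (c * t)}" for P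
  proof (intro equalityI subsetI)
    fix u assume "u \<in> {ennreal t |t. 0 \<le> t \<and> P t}"
    then obtain t where t: "u = ennreal t" "0 \<le> t" "P t" by blast
    then have "u = ennreal (t / c) * ennreal c" "P (c * (t / c))" "0 \<le> t / c"
      using assms(1) by (simp_all add: ennreal_mult[symmetric])
    then show "u \<in> (\<lambda>u. u * ennreal c) ` {ennreal t |t. 0 \<le> t \<and> P (c * t)}" by blast
  next
    fix u assume "u \<in> (\<lambda>u. u * ennreal c) ` {ennreal t |t. 0 \<le> t \<and> P (c * t)}"
    then obtain t where t: "u = ennreal t * ennreal c" "0 \<le> t" "P (c * t)" by blast
    then have "u = ennreal (c * t)" "0 \<le> c * t"
      using assms(1) by (simp_all add: ennreal_mult[symmetric] mult.commute)
    then show "u \<in> {ennreal t |t. 0 \<le> t \<and> P t}" using t(3) by blast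
  qed
  have Inf_scale: "Inf ((\<lambda>u. u * ennreal c) ` S) / ennreal c = Inf S" for S
  proof -
    have c: "0 < ennreal c" "ennreal c \<noteq> top" using assms(1) by auto
    have "x \<le> Inf ((\<lambda>u. u * ennreal c) ` S) / ennreal c \<longleftrightarrow> x \<le> Inf S" for x
    proof -
      have "x \<le> Inf ((\<lambda>u. u * ennreal c) ` S) / ennreal c \<longleftrightarrow> x * ennreal c \<le> Inf ((\<lambda>u. u * ennreal c) ` S)"
        using c divide_less_ennreal[of "ennreal c" "Inf ((\<lambda>u. u * ennreal c) ` S)" x]
        by (simp add: not_less[symmetric] less_top)
      also have "\<dots> \<longleftrightarrow> (\<forall>u\<in>S. x * ennreal c \<le> u * ennreal c)" by (auto simp: le_Inf_iff)
      also have "\<dots> \<longleftrightarrow> x \<le> Inf S" using c by (simp add: le_Inf_iff ennreal_mult_le_mult_iff mult.commute[of _ "ennreal c"])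
      finally show ?thesis .
    qed
    then show ?thesis by (meson order.antisym order.refl)
  qed
  have "exit_time (b * ereal \<kappa>) (a * ereal \<kappa>) f = Inf {ennreal t |t. 0 \<le> t \<and> ereal (f t / \<kappa>) \<notin> {- b<..<a}}"
    by (simp only: exit_time_def levels)
  also have "\<dots> / ennreal c = exit_time b a (\<lambda>t. f (c * t) / \<kappa>)"
    by (subst times) (simp only: Inf_scale exit_time_def)
  finally show ?thesis .
qed

text \<open>Each of the three times is an exit time from an interval: the one-sided passage time has the
  other endpoint at infinity, and for the modulus the interval is symmetric.\<close>

theorem corollary4p6:
  fixes M :: "'m measure" and N :: "'n measure"
    and \<alpha> :: real and a b :: ereal
    and Z :: "real \<Rightarrow> 'm \<Rightarrow> complex"
    and \<theta> :: "real \<Rightarrow> 'm \<Rightarrow> real"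
    and \<zeta> :: "real \<Rightarrow> 'n \<Rightarrow> real"
  assumes "0 < \<alpha>" "\<alpha> < 2"
    and "prob_space M" "prob_space N"
    and "standard_planar_stable_from_1 M \<alpha> Z"
    and "winding_process M Z \<theta>"
    and "symmetric_stable_process N \<alpha> \<zeta>"
    and "converges_in_law skorohod_topology (at_right 0)
           M (\<lambda>c \<omega> t. c powr (- 1 / \<alpha>) * \<theta> (c * t) \<omega>)
           N (\<lambda>\<omega> t. \<zeta> t \<omega>)"
    and "0 < a" "0 < b"
  shows "converges_in_law euclidean (at_right (0::real))
           M (\<lambda>c \<omega>. first_passage (a * ereal (c powr (1 / \<alpha>))) (\<lambda>t. \<theta> t \<omega>) / ennreal c)
           N (\<lambda>\<omega>. first_passage a (\<lambda>t. \<zeta> t \<omega>)) \<and>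
         converges_in_law euclidean (at_right (0::real))
           M (\<lambda>c \<omega>. first_passage (a * ereal (c powr (1 / \<alpha>))) (\<lambda>t. \<bar>\<theta> t \<omega>\<bar>) / ennreal c)
           N (\<lambda>\<omega>. first_passage a (\<lambda>t. \<bar>\<zeta> t \<omega>\<bar>)) \<and>
         converges_in_law euclidean (at_right (0::real))
           M (\<lambda>c \<omega>. exit_time (b * ereal (c powr (1 / \<alpha>))) (a * ereal (c powr (1 / \<alpha>))) (\<lambda>t. \<theta> t \<omega>) / ennreal c)
           N (\<lambda>\<omega>. exit_time b a (\<lambda>t. \<zeta> t \<omega>))"
proof -
  have \<theta>: "cadlag_process M \<theta>" using assms(6) by (simp add: winding_process_def)
  have \<zeta>: "cadlag_process N \<zeta>"
    using assms(7) by (auto simp: symmetric_stable_process_def isotropic_stable_process_def)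
  have ev_pos: "\<forall>\<^sub>F c::real in at_right 0. 0 < c" by (simp add: eventually_at_filter)
  have exit: "converges_in_law euclidean (at_right (0::real))
           M (\<lambda>c \<omega>. exit_time (y * ereal (c powr (1 / \<alpha>))) (x * ereal (c powr (1 / \<alpha>))) (\<lambda>t. \<theta> t \<omega>) / ennreal c)
           N (\<lambda>\<omega>. exit_time y x (\<lambda>t. \<zeta> t \<omega>))"
    if "0 < x" "0 < y" for x y :: ereal
  proof -
    obtain A B where AB: "0 \<le> A" "0 \<le> B"
      "\<And>f. exit_time y x f = first_passage 1 (\<lambda>t. max (A * f t) (- (B * f t)))"
      using exit_time_eq_first_passage_gauge[OF \<open>0 < x\<close> \<open>0 < y\<close>] by blast
    let ?g = "\<lambda>v. max (A * v) (- (B * v))"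
    have eq: "\<forall>\<^sub>F c in at_right 0. \<forall>\<omega>.
        exit_time (y * ereal (c powr (1 / \<alpha>))) (x * ereal (c powr (1 / \<alpha>))) (\<lambda>t. \<theta> t \<omega>) / ennreal c =
        first_passage 1 (\<lambda>t. ?g (c powr (- 1 / \<alpha>) * \<theta> (c * t) \<omega>))"
      using ev_pos
    proof eventually_elim
      case (elim c)
      then have "c powr (- 1 / \<alpha>) * v = v / c powr (1 / \<alpha>)" for v
        by (simp add: powr_minus field_simps)
      then show ?case
        using elim exit_time_scale[OF elim, of "c powr (1 / \<alpha>)" y x] by (simp add: AB(3))
    qed
    have "converges_in_law euclidean (at_right 0)
        M (\<lambda>c \<omega>. first_passage 1 (\<lambda>t. ?g (c powr (- 1 / \<alpha>) * \<theta> (c * t) \<omega>)))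
        N (\<lambda>\<omega>. first_passage 1 (\<lambda>t. ?g (\<zeta> t \<omega>)))"
    proof (rule first_passage_converges_in_law[OF assms(1,3,4) \<theta> \<zeta> assms(8)])
      show "0 \<le> A + B" using AB by simp
      show "\<bar>?g u - ?g v\<bar> \<le> (A + B) * \<bar>u - v\<bar>" for u v
      proof -
        have "\<bar>A * u - A * v\<bar> = A * \<bar>u - v\<bar>" "\<bar>B * u - B * v\<bar> = B * \<bar>u - v\<bar>"
          using AB by (simp_all add: right_diff_distrib[symmetric] abs_mult)
        then show ?thesis unfolding distrib_right by linarith
      qed
      show "?g (k * v) = k * ?g v" if "0 < k" for k v
        using that by (simp add: max_mult_distrib_left mult.left_commute)
    qed
    then show ?thesis unfolding converges_in_law_cong[OF eq] AB(3) .
  qed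
  have zero_less_top: "0 < (\<infinity> :: ereal)" by simp
  have one_sided: "\<forall>\<^sub>F c in at_right 0. \<forall>\<omega>.
      first_passage (a * ereal (c powr (1 / \<alpha>))) (\<lambda>t. \<theta> t \<omega>) / ennreal c =
      exit_time (\<infinity> * ereal (c powr (1 / \<alpha>))) (a * ereal (c powr (1 / \<alpha>))) (\<lambda>t. \<theta> t \<omega>) / ennreal c"
    using ev_pos by eventually_elim (simp add: exit_time_one_sided)
  have "converges_in_law euclidean (at_right (0::real))
           M (\<lambda>c \<omega>. first_passage (a * ereal (c powr (1 / \<alpha>))) (\<lambda>t. \<theta> t \<omega>) / ennreal c)
           N (\<lambda>\<omega>. first_passage a (\<lambda>t. \<zeta> t \<omega>))"
    unfolding converges_in_law_cong[OF one_sided]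
    using exit[OF \<open>0 < a\<close> zero_less_top] by (simp only: exit_time_one_sided)
  with exit[OF \<open>0 < a\<close> \<open>0 < a\<close>] exit[OF \<open>0 < a\<close> \<open>0 < b\<close>] show ?thesis
    unfolding exit_time_symmetric by blast
qed

end
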